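(* Let $F$ be a distribution function on $\mathbb{R}$ (not necessarily continuous), let $\{\mathscr{M}_t\}_{t>0}$ be the extremal process associated with $F$ (defined in the context), let $b_t$, $t\ge0$, be a non-decreasing right-continuous real-valued function, and put $g_t:=1-F(b_t)$. Then: (i) One always has $\mathbf{P}(\mathscr{M}_t>b_t\ \text{ev.})=0$ or $1$. (ii) If $g_t\to c>0$ as $t\to\infty$, then $\mathbf{P}(\mathscr{M}_t>b_t\ \text{ev.})=1$. (iii) If $\lim_{t\to\infty}g_t=0$ and $\liminf_{t\to\infty}tg_t<\infty$, then $\mathbf{P}(\mathscr{M}_t>b_t\ \text{ev.})=0$. (iv) If $\lim_{t\to\infty}g_t=0$ and $\lim_{t\to\infty}tg_t=\infty$, then $$\mathbf{P}(\mathscr{M}_t>b_t\ \text{ev.})=\begin{cases}0 & \text{if } J(b)=\infty,\\ 1 & \text{if } J(b)<\infty,\end{cases}\qquad\text{where } J(b):=\int_0^\infty g_te^{-tg_t}\,dt.$$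
   Context: Let $x_0:=\inf\{x\in\mathbb{R}:F(x)>0\}$; it is assumed that $F(x_0)=0$ if $x_0>-\infty$. Let $\mathscr{P}$ be a Poisson point process on $\mathbb{R}^2$ with intensity measure $\lambda$ specified by $\lambda\bigl((a,b)\times(x,\infty)\bigr)=(a-b)\ln F(x)$ for $a<b$, $x>x_0$, and $\lambda\bigl(\mathbb{R}\times(-\infty,x_0]\bigr)=0$. For $B\subset\mathbb{R}$ put $L(B):=\inf\{x\in\mathbb{R}:\mathscr{P}(B\times(x,\infty))=0\}$. The extremal process associated with $F$ is $\mathscr{M}_t:=L((0,t])$, $t>0$ (so that $\mathbf{P}(\mathscr{M}_t\le x)=F^t(x)$). $\{\mathscr{M}_t>b_t\ \text{ev.}\}$ denotes the event that $\mathscr{M}_t>b_t$ eventually, i.e. that $\sup\{t>0:\mathscr{M}_t\le b_t\}<\infty$ (equivalently, $\mathscr{M}_t>b_t$ for all sufficiently large $t$). *)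

theory Defs
  imports "HOL-Probability.Probability"
begin

(* A point process is a random integer-valued measure, with values in {0,1,2,...,\<infinity>}.
   Infinite values have to be allowed: the intensities of interest are not finite on bounded sets.
   A Poisson variable of mean \<infinity> is a.s. infinite. *)

locale poisson_point_process = prob_space \<Omega>
  for \<Omega> :: "'w measure" and N :: "'w \<Rightarrow> 'a measure" and \<Lambda> :: "'a measure" +
  assumes sets_realization: "\<And>\<omega>. \<omega> \<in> space \<Omega> \<Longrightarrow> sets (N \<omega>) = sets \<Lambda>"
    and integer_valued: "\<And>\<omega> A. \<omega> \<in> space \<Omega> \<Longrightarrow> A \<in> sets \<Lambda> \<Longrightarrow>
          emeasure (N \<omega>) A = \<infinity> \<or> (\<exists>k::nat. emeasure (N \<omega>) A = of_nat k)"
    and random_count: "\<And>A. A \<in> sets \<Lambda> \<Longrightarrow> random_variable borel (\<lambda>\<omega>. emeasure (N \<omega>) A)"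
    and poisson_finite: "\<And>A k. A \<in> sets \<Lambda> \<Longrightarrow> emeasure \<Lambda> A < \<infinity> \<Longrightarrow>
          prob {\<omega> \<in> space \<Omega>. emeasure (N \<omega>) A = of_nat k}
            = measure \<Lambda> A ^ k / fact k * exp (- measure \<Lambda> A)"
    and poisson_infinite: "\<And>A. A \<in> sets \<Lambda> \<Longrightarrow> emeasure \<Lambda> A = \<infinity> \<Longrightarrow>
          AE \<omega> in \<Omega>. emeasure (N \<omega>) A = \<infinity>"
    and independent_counts: "\<And>(I :: nat set) A. finite I \<Longrightarrow> A ` I \<subseteq> sets \<Lambda> \<Longrightarrow>
          disjoint_family_on A I \<Longrightarrow>
          indep_vars (\<lambda>_. borel) (\<lambda>i \<omega>. emeasure (N \<omega>) (A i)) I"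

definition lower_endpoint :: "(real \<Rightarrow> real) \<Rightarrow> ereal" where
  "lower_endpoint F = Inf (ereal ` {x. F x > 0})"

definition extremal_intensity :: "(real \<Rightarrow> real) \<Rightarrow> (real \<times> real) measure \<Rightarrow> bool" where
  "extremal_intensity F \<Lambda> \<longleftrightarrow>
     sets \<Lambda> = sets borel \<and>
     (\<forall>a b x. a < b \<longrightarrow> lower_endpoint F < ereal x \<longrightarrow>
        emeasure \<Lambda> ({a<..<b} \<times> {x<..}) = ennreal ((a - b) * ln (F x))) \<and>
     emeasure \<Lambda> (UNIV \<times> {x. ereal x \<le> lower_endpoint F}) = 0"

(* Extended-real valued: on a null set of realizations the infimum may fail to be finite. *)
definition max_level :: "(real \<times> real) measure \<Rightarrow> real set \<Rightarrow> ereal" where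
  "max_level \<mu> B = Inf (ereal ` {x. emeasure \<mu> (B \<times> {x<..}) = 0})"

definition extremal_process :: "('w \<Rightarrow> (real \<times> real) measure) \<Rightarrow> real \<Rightarrow> 'w \<Rightarrow> ereal" where
  "extremal_process N t \<omega> = max_level (N \<omega>) {0<..t}"

definition eventually_above ::
    "'w measure \<Rightarrow> (real \<Rightarrow> 'w \<Rightarrow> ereal) \<Rightarrow> (real \<Rightarrow> real) \<Rightarrow> 'w set" where
  "eventually_above \<Omega> M b = {\<omega> \<in> space \<Omega>. \<forall>\<^sub>F t in at_top. M t \<omega> > ereal (b t)}"

definition J_integral :: "(real \<Rightarrow> real) \<Rightarrow> ennreal" where
  "J_integral g = (\<integral>\<^sup>+ t \<in> {0..}. ennreal (g t * exp (- t * g t)) \<partial>lborel)"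

end

theory Submission
  imports Defs
begin

text \<open>
  Everything is reduced to void events of the point process, that is, to the events that a given
  region carries no point.  The extremal process at time \<open>t\<close> is at most \<open>x\<close> if and only if the strip
  \<open>{0<..t} \<times> {x<..}\<close> is void, and a strip \<open>{m<..n} \<times> {x<..}\<close> with integers \<open>m \<le> n\<close> is void with
  probability \<open>F x ^ (n - m)\<close>.  The boundary does not decrease, so it suffices to look at integer
  times.

  The quantity that decides is the number of exits: the integers \<open>k\<close> such that the process is below
  the boundary at time \<open>k\<close> and a point above the level at time \<open>k\<close> arrives during the next unit of
  time.  At the levels \<open>b k\<close> an exit has probability \<open>(1 - g k) ^ k * g k\<close>, which is a discrete form of
  the integrand \<open>g t * exp (- t * g t)\<close>.  As \<open>t * g t\<close> tends to infinity, the sum of these probabilities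
  and the integral \<open>J\<close> converge or diverge together.

  If \<open>J\<close> is finite, only finitely many exits occur by the first Borel-Cantelli lemma
  (\<open>AE_eventually_not_below\<close>).  A visit below the boundary after the last exit would have to last
  forever, which has probability zero.

  If \<open>J\<close> is infinite, the exits are not independent, but the two-point bound
  (\<open>two_point_bound\<close>, \<open>sum_two_point_bound\<close>) shows that the second moment of their number is of the
  order of the squared first moment.  Hence infinitely many exits occur with positive probability
  (\<open>second_borel_cantelli_correlated\<close>).  It remains to raise this probability to one.  As \<open>g\<close> tends to
  zero, the points in any bounded time interval are eventually irrelevant, so up to a null set the
  event of being below the boundary infinitely often is a tail event, and Kolmogorov's law applies
  (\<open>below_infinitely_often_zero_one\<close>).  The same law settles the case where \<open>t * g t\<close> does not tend to
  infinity: then the process is below the boundary with a probability bounded away from zero at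
  infinitely many integer times.

  If \<open>g\<close> has a positive limit, the probability of being below the boundary decays geometrically.
  As \<open>g\<close> is monotone and bounded, no other case can occur, so the zero-one alternative in the first
  assertion follows from the other ones.
\<close>

section \<open>Events that occur infinitely often\<close>

lemma mem_limsup_iff_frequently:
  fixes A :: "nat \<Rightarrow> 'a set"
  shows "x \<in> limsup A \<longleftrightarrow> (\<exists>\<^sub>F n in sequentially. x \<in> A n)"
  by (auto simp: limsup_INF_SUP frequently_sequentially)

lemma (in prob_space) prob_limsup_ge:
  assumes A [measurable]: "\<And>n. A n \<in> events"
    and ge: "\<And>s. c \<le> prob (\<Union>k\<in>{s..}. A k)"
  shows "c \<le> prob (limsup A)"
proof -
  have "(\<lambda>s. prob (\<Union>k\<in>{s..}. A k)) \<longlonglongrightarrow> prob (\<Inter>s. \<Union>k\<in>{s..}. A k)"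
    by (rule finite_Lim_measure_decseq) (force simp: decseq_def intro!: sets.countable_UN'')+
  then show ?thesis
    unfolding limsup_INF_SUP using ge by (intro LIMSEQ_le_const) auto
qed

text \<open>
  This is the easy half of a Borel-Cantelli argument: probabilities that do not tend to \<open>0\<close> already
  prevent the upper limit from being null, without any independence.
\<close>

lemma (in prob_space) prob_limsup_ge_frequently:
  assumes A [measurable]: "\<And>n. A n \<in> events"
    and fr: "\<exists>\<^sub>F k in sequentially. c \<le> prob (A k)"
  shows "c \<le> prob (limsup A)"
proof (rule prob_limsup_ge[OF A])
  fix s
  obtain k where k: "k \<ge> s" "c \<le> prob (A k)"
    using fr by (auto simp: frequently_sequentially)
  have "prob (A k) \<le> prob (\<Union>k\<in>{s..}. A k)"
    using k by (intro finite_measure_mono) (auto intro!: sets.countable_UN'')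
  with k show "c \<le> prob (\<Union>k\<in>{s..}. A k)" by simp
qed

text \<open>
  The indicator of a union dominates \<open>2 * l * U - l\<^sup>2 * U\<^sup>2\<close> for every \<open>l\<close>, where \<open>U\<close> counts the
  events that occur: the difference to \<open>1\<close> is the square \<open>(1 - l * U)\<^sup>2\<close>, and both sides vanish
  when \<open>U = 0\<close>.  Optimising over \<open>l\<close> would give the inequality of Chung and Erdos.
\<close>

lemma (in prob_space) prob_UN_ge_second_moment:
  fixes A :: "nat \<Rightarrow> 'a set"
  assumes I: "finite I" and A: "\<And>i. i \<in> I \<Longrightarrow> A i \<in> events"
  shows "2 * l * (\<Sum>i\<in>I. prob (A i)) - l\<^sup>2 * (\<Sum>i\<in>I. \<Sum>j\<in>I. prob (A i \<inter> A j))
           \<le> prob (\<Union>i\<in>I. A i)"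
proof -
  define U where "U x = (\<Sum>i\<in>I. indicator (A i) x :: real)" for x
  have meas [measurable]: "(\<Union>i\<in>I. A i) \<in> events" using I A by auto
  have int1: "integrable M U"
    unfolding U_def using A by (intro Bochner_Integration.integrable_sum) (auto simp: less_top[symmetric])
  have sq: "(U x)\<^sup>2 = (\<Sum>i\<in>I. \<Sum>j\<in>I. indicator (A i \<inter> A j) x)" for x
    unfolding U_def power2_eq_square sum_product by (simp add: indicator_inter_arith)
  have int2: "integrable M (\<lambda>x. (U x)\<^sup>2)"
    unfolding sq using A
    by (intro Bochner_Integration.integrable_sum) (auto simp: less_top[symmetric])
  have "2 * l * (\<Sum>i\<in>I. prob (A i)) - l\<^sup>2 * (\<Sum>i\<in>I. \<Sum>j\<in>I. prob (A i \<inter> A j))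
      = 2 * l * expectation U - l\<^sup>2 * expectation (\<lambda>x. (U x)\<^sup>2)"
  proof -
    have "expectation U = (\<Sum>i\<in>I. prob (A i))"
      unfolding U_def using A by (subst Bochner_Integration.integral_sum) (auto simp: less_top[symmetric])
    moreover have "expectation (\<lambda>x. (U x)\<^sup>2) = (\<Sum>i\<in>I. \<Sum>j\<in>I. prob (A i \<inter> A j))"
      unfolding sq using A
      by (subst Bochner_Integration.integral_sum, force simp: less_top[symmetric], intro sum.cong refl,
          subst Bochner_Integration.integral_sum) (auto simp: less_top[symmetric])
    ultimately show ?thesis by simp
  qed
  also have "\<dots> = expectation (\<lambda>x. 2 * l * U x - l\<^sup>2 * (U x)\<^sup>2)"
    using int1 int2 by simp
  also have "\<dots> \<le> expectation (indicator (\<Union>i\<in>I. A i))"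
  proof (rule integral_mono)
    show "integrable M (\<lambda>x. 2 * l * U x - l\<^sup>2 * (U x)\<^sup>2)" using int1 int2 by simp
    show "integrable M (indicator (\<Union>i\<in>I. A i) :: _ \<Rightarrow> real)"
      by (simp add: less_top[symmetric])
    fix x
    show "2 * l * U x - l\<^sup>2 * (U x)\<^sup>2 \<le> indicator (\<Union>i\<in>I. A i) x"
    proof (cases "x \<in> (\<Union>i\<in>I. A i)")
      case True
      have "2 * l * U x - l\<^sup>2 * (U x)\<^sup>2 = 1 - (1 - l * U x)\<^sup>2"
        by (simp add: power2_eq_square algebra_simps)
      also have "\<dots> \<le> 1" by simp
      finally show ?thesis using True by simp
    next
      case False
      then have "U x = 0" unfolding U_def by (intro sum.neutral) auto
      then show ?thesis by simp
    qed
  qed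
  also have "\<dots> = prob (\<Union>i\<in>I. A i)" by simp
  finally show ?thesis .
qed

text \<open>
  The square of a sum is the diagonal plus twice the part below it; the same identity serves once
  for joint probabilities and once for products of probabilities.
\<close>

lemma sum_symmetric_split:
  fixes f :: "nat \<Rightarrow> nat \<Rightarrow> real"
  assumes sym: "\<And>i j. f i j = f j i"
  shows "(\<Sum>i\<in>{s..<n}. \<Sum>j\<in>{s..<n}. f i j)
           = (\<Sum>k\<in>{s..<n}. f k k) + 2 * (\<Sum>k\<in>{s..<n}. \<Sum>j\<in>{s..<k}. f j k)"
proof (induction n)
  case 0
  then show ?case by simp
next
  case (Suc n)
  show ?case
  proof (cases "s \<le> n")
    case True
    have "(\<Sum>i\<in>{s..<n}. f i n) = (\<Sum>i\<in>{s..<n}. f n i)" by (intro sum.cong) (auto simp: sym)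
    with True Suc show ?thesis
      by (simp add: atLeastLessThanSuc sum.distrib)
  next
    case False
    then show ?thesis by simp
  qed
qed

text \<open>
  The bound on the joint probabilities says that, up to constants, the events are pairwise no more
  correlated than independent events, apart from a diagonal contribution proportional to the sum
  itself.  Once that sum is large, the second-moment bound keeps the probability of a union of the
  events at or above \<open>1/3\<close>.
\<close>

lemma (in prob_space) second_borel_cantelli_correlated:
  assumes A [measurable]: "\<And>n. A n \<in> events"
    and div: "\<not> summable (\<lambda>n. prob (A n))"
    and pairs: "\<And>s n. (\<Sum>k\<in>{s..<n}. \<Sum>j\<in>{s..<k}. prob (A j \<inter> A k))
          \<le> (\<Sum>k\<in>{s..<n}. prob (A k))\<^sup>2 + 4 * (\<Sum>k\<in>{s..<n}. prob (A k))"
  shows "prob (limsup A) > 0"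
proof -
  have "1/3 \<le> prob (\<Union>k\<in>{s..}. A k)" for s
  proof -
    have "\<exists>n. (\<Sum>k\<in>{s..<n}. prob (A k)) \<ge> 9"
    proof (rule ccontr)
      assume "\<not> ?thesis"
      then have le: "(\<Sum>k\<in>{s..<n}. prob (A k)) \<le> 9" for n by (simp add: not_le less_imp_le)
      have "summable (\<lambda>k. prob (A (k + s)))"
      proof (rule summableI_nonneg_bounded)
        show "(\<Sum>k<n. prob (A (k + s))) \<le> 9" for n
          using le[of "n + s"] sum.shift_bounds_nat_ivl[of "\<lambda>k. prob (A k)" 0 s n]
          by (simp add: lessThan_atLeast0)
      qed simp
      then have "summable (\<lambda>k. prob (A k))" by (rule summable_iff_shift[THEN iffD1])
      with div show False by blast
    qed
    then obtain n where n: "(\<Sum>k\<in>{s..<n}. prob (A k)) \<ge> 9" by auto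
    define S where "S = (\<Sum>k\<in>{s..<n}. prob (A k))"
    have S: "S \<ge> 9" using n by (simp add: S_def)
    have "(\<Sum>i\<in>{s..<n}. \<Sum>j\<in>{s..<n}. prob (A i \<inter> A j))
        = S + 2 * (\<Sum>k\<in>{s..<n}. \<Sum>j\<in>{s..<k}. prob (A j \<inter> A k))"
      by (subst sum_symmetric_split) (auto simp: Int_commute S_def)
    also have "\<dots> \<le> S + 2 * (S\<^sup>2 + 4 * S)"
      using pairs[of s n] by (simp add: S_def)
    also have "\<dots> \<le> 3 * S\<^sup>2"
      using S mult_right_mono[of 9 S S] by (simp add: power2_eq_square)
    finally have second: "(\<Sum>i\<in>{s..<n}. \<Sum>j\<in>{s..<n}. prob (A i \<inter> A j)) \<le> 3 * S\<^sup>2" .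
    \<comment> \<open>\<open>l = 1 / (3 * S)\<close> maximises \<open>2 * l * S - l\<^sup>2 * (3 * S\<^sup>2)\<close>.\<close>
    have "1/3 = 2 * (1 / (3 * S)) * S - (1 / (3 * S))\<^sup>2 * (3 * S\<^sup>2)"
      using S by (simp add: field_simps power2_eq_square)
    also have "\<dots> \<le> 2 * (1 / (3 * S)) * S
        - (1 / (3 * S))\<^sup>2 * (\<Sum>i\<in>{s..<n}. \<Sum>j\<in>{s..<n}. prob (A i \<inter> A j))"
      by (intro diff_left_mono mult_left_mono second) simp
    also have "\<dots> \<le> prob (\<Union>k\<in>{s..<n}. A k)"
      unfolding S_def by (rule prob_UN_ge_second_moment) auto
    also have "\<dots> \<le> prob (\<Union>k\<in>{s..}. A k)"
      by (intro finite_measure_mono) (auto intro!: sets.countable_UN'')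
    finally show ?thesis .
  qed
  from prob_limsup_ge[OF A this] show ?thesis by simp
qed

section \<open>Correlations between exits\<close>

text \<open>
  In \<open>(y - x) * (\<Sum>i\<le>n. y ^ i * x ^ (n - i)) = y ^ (n + 1) - x ^ (n + 1)\<close> each of the \<open>n + 1\<close>
  terms of the sum is at least \<open>x ^ n\<close>.  The gain is the factor \<open>1 / (n + 1)\<close>.
\<close>

lemma pow_times_diff_le:
  fixes x y :: real
  assumes "0 \<le> x" "x \<le> y"
  shows "real (Suc n) * (x ^ n * (y - x)) \<le> y ^ Suc n"
proof -
  have "real (Suc n) * (x ^ n * (y - x)) = (y - x) * (\<Sum>i<Suc n. x ^ n)" by simp
  also have "\<dots> \<le> (y - x) * (\<Sum>i<Suc n. y ^ i * x ^ (n - i))"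
  proof (intro mult_left_mono sum_mono)
    fix i assume i: "i \<in> {..<Suc n}"
    then have "x ^ n = x ^ i * x ^ (n - i)" by (simp flip: power_add)
    also have "\<dots> \<le> y ^ i * x ^ (n - i)" using assms by (intro mult_right_mono power_mono) auto
    finally show "x ^ n \<le> y ^ i * x ^ (n - i)" .
  qed (use assms in simp)
  also have "\<dots> = y ^ Suc n - x ^ Suc n"
    by (simp only: power_diff_sumr2[of y "Suc n" x]) (simp add: mult.commute)
  also have "\<dots> \<le> y ^ Suc n" using assms by simp
  finally show ?thesis .
qed

text \<open>
  The function \<open>x ^ n * (1 - x)\<close> increases up to its maximum at \<open>n / (n + 1)\<close>, and the last
  hypothesis says that \<open>y\<close> lies to the left of that maximum.
\<close>

lemma pow_times_complement_mono:
  fixes x y :: real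
  assumes "0 \<le> x" "x \<le> y" "real (Suc n) * (1 - y) \<ge> 1"
  shows "x ^ n * (1 - x) \<le> y ^ n * (1 - y)"
proof (cases n)
  case 0
  then have "x = y" using assms by simp
  then show ?thesis by simp
next
  case (Suc m)
  show ?thesis
  proof (rule DERIV_nonneg_imp_nondecreasing[where f = "\<lambda>t. t ^ n * (1 - t)"])
    show "x \<le> y" by fact
    fix t assume t: "x \<le> t" "t \<le> y"
    have "((\<lambda>t. t ^ n * (1 - t)) has_real_derivative (real n * t ^ (n - 1) * (1 - t) - t ^ n)) (at t)"
      by (auto intro!: derivative_eq_intros simp: algebra_simps)
    moreover have "0 \<le> real n * t ^ (n - 1) * (1 - t) - t ^ n"
    proof -
      have "real (Suc n) * t \<le> real (Suc n) * y" using t by (intro mult_left_mono) auto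
      then have "real n * (1 - t) - t \<ge> 0" using assms(3) by (simp add: algebra_simps)
      then have "0 \<le> t ^ m * (real n * (1 - t) - t)" using assms t by (intro mult_nonneg_nonneg) auto
      then show ?thesis using Suc by (simp add: algebra_simps)
    qed
    ultimately show "\<exists>d. ((\<lambda>t. t ^ n * (1 - t)) has_real_derivative d) (at t) \<and> 0 \<le> d" by blast
  qed
qed

text \<open>
  For \<open>j < k\<close> the left-hand side is the probability of exits at both times \<open>j\<close> and \<open>k\<close> when \<open>x\<close> and
  \<open>y\<close> are the values of \<open>F\<close> on the boundary at these times; \<open>x ^ j * (1 - x)\<close> and \<open>y ^ k * (1 - y)\<close>
  are the probabilities of the single exits.  Each term on the right takes care of one regime.
  If \<open>y\<close> is so close to \<open>1\<close> that \<open>y ^ (j + 1) \<ge> 1/2\<close>, the past up to \<open>j\<close> costs the event at \<open>k\<close> at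
  most a factor \<open>2\<close>, and the exits are nearly independent.
  If \<open>k\<close> is comparable with \<open>j\<close>, condition on the exit at \<open>k\<close>: an exit at \<open>j\<close> needs that no point up to
  time \<open>j\<close> falls between the two levels and that one does right afterwards, which has conditional
  probability at most \<open>1 / (j + 1)\<close>; the sum of this over the \<open>j\<close> in question is bounded.
  If \<open>k\<close> is much larger than \<open>j\<close> and \<open>y\<close> is not close to \<open>1\<close>, the second exit is geometrically unlikely.
\<close>

lemma two_point_bound:
  fixes x y :: real
  assumes xy: "0 \<le> x" "x \<le> y" "y \<le> 1" and jk: "j < k"
    and \<theta>: "\<theta> = 1 - 1 / (2 * real (Suc j))"
  shows "x ^ j * y ^ (k - j - 1) * (y - x) * (1 - y)
     \<le> 2 * ((x ^ j * (1 - x)) * (y ^ k * (1 - y)))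
       + (x ^ j * (1 - x)) * (\<theta> ^ (k - j - 1) * (1 - \<theta>))
       + 3 / real (Suc k) * (y ^ k * (1 - y))"
    (is "?f \<le> ?R1 + ?R2 + ?R3")
proof -
  have \<theta>0: "0 \<le> \<theta>" "\<theta> \<le> 1" by (auto simp: \<theta> field_simps)
  have nonneg: "0 \<le> ?R1" "0 \<le> ?R2" "0 \<le> ?R3" using xy \<theta>0 by auto
  have f_le: "?f \<le> (x ^ j * (1 - x)) * (y ^ (k - j - 1) * (1 - y))"
  proof -
    have "?f = (x ^ j * (y - x)) * (y ^ (k - j - 1) * (1 - y))" by simp
    also have "\<dots> \<le> (x ^ j * (1 - x)) * (y ^ (k - j - 1) * (1 - y))"
      using xy by (intro mult_right_mono mult_left_mono) auto
    finally show ?thesis .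
  qed
  have split: "y ^ k = y ^ Suc j * y ^ (k - j - 1)"
    using jk by (simp flip: power_add power_Suc)
  consider "y > \<theta>" | "y \<le> \<theta>" "k < 3 * j + 2" | "y \<le> \<theta>" "k \<ge> 3 * j + 2" by linarith
  then show ?thesis
  proof cases
    case 1
    have "1 / 2 = 1 + real (Suc j) * (- 1 / (2 * real (Suc j)))" by (simp add: field_simps)
    also have "\<dots> \<le> (1 + (- 1 / (2 * real (Suc j)))) ^ Suc j"
      by (rule Bernoulli_inequality) (simp add: field_simps)
    also have "\<dots> = \<theta> ^ Suc j" by (simp add: \<theta>)
    also have "\<dots> \<le> y ^ Suc j" using 1 \<theta>0 by (intro power_mono) auto
    finally have "1 \<le> 2 * y ^ Suc j" by simp
    then have "y ^ (k - j - 1) \<le> 2 * y ^ k"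
      using mult_right_mono[of 1 "2 * y ^ Suc j" "y ^ (k - j - 1)"] xy by (simp add: split)
    then have "(x ^ j * (1 - x)) * (y ^ (k - j - 1) * (1 - y)) \<le> (x ^ j * (1 - x)) * (2 * y ^ k * (1 - y))"
      using xy by (intro mult_left_mono mult_right_mono) auto
    also have "\<dots> = ?R1" by simp
    finally show ?thesis using f_le nonneg by linarith
  next
    case 2
    have "real (Suc k) * ?f = real (Suc k) * (x ^ j * (y - x)) * (y ^ (k - j - 1) * (1 - y))" by simp
    also have "\<dots> \<le> 3 * y ^ Suc j * (y ^ (k - j - 1) * (1 - y))"
    proof (intro mult_right_mono)
      have "real (Suc k) * (x ^ j * (y - x)) \<le> (3 * real (Suc j)) * (x ^ j * (y - x))"
        using 2 xy by (intro mult_right_mono) auto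
      also have "\<dots> = 3 * (real (Suc j) * (x ^ j * (y - x)))" by simp
      also have "\<dots> \<le> 3 * y ^ Suc j"
        using pow_times_diff_le[of x y j] xy by (intro mult_left_mono) auto
      finally show "real (Suc k) * (x ^ j * (y - x)) \<le> 3 * y ^ Suc j" .
    qed (use xy in auto)
    also have "\<dots> = 3 * (y ^ k * (1 - y))" by (simp add: split)
    finally have "?f \<le> ?R3" by (simp add: field_simps)
    then show ?thesis using nonneg by linarith
  next
    case 3
    have "real (3 * j + 2) \<le> real k" using 3 by (simp only: of_nat_le_iff)
    then have "2 * real (Suc j) \<le> real (Suc (k - j - 1))"
      using jk by (simp add: of_nat_diff)
    then have "real (Suc (k - j - 1)) * (1 - \<theta>) \<ge> 1" by (simp add: \<theta> field_simps)
    then have "y ^ (k - j - 1) * (1 - y) \<le> \<theta> ^ (k - j - 1) * (1 - \<theta>)"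
      using 3 xy by (intro pow_times_complement_mono) auto
    then have "(x ^ j * (1 - x)) * (y ^ (k - j - 1) * (1 - y)) \<le> ?R2"
      using xy by (intro mult_left_mono) auto
    then show ?thesis using f_le nonneg by linarith
  qed
qed

text \<open>
  Summed over \<open>k\<close>, the weights \<open>\<theta> ^ (k - j - 1) * (1 - \<theta>)\<close> of a geometric distribution telescope.
\<close>

lemma sum_geometric_kernel:
  fixes w \<theta> :: "nat \<Rightarrow> real"
  shows "(\<Sum>k\<in>{s..<n}. \<Sum>j\<in>{s..<k}. w j * (\<theta> j ^ (k - j - 1) * (1 - \<theta> j)))
           = (\<Sum>j\<in>{s..<n}. w j * (1 - \<theta> j ^ (n - j - 1)))"
proof (induction n)
  case 0
  then show ?case by simp
next
  case (Suc n)
  show ?case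
  proof (cases "s \<le> n")
    case True
    have "(\<Sum>j\<in>{s..<n}. w j * (1 - \<theta> j ^ (n - j - 1)))
          + (\<Sum>j\<in>{s..<n}. w j * (\<theta> j ^ (n - j - 1) * (1 - \<theta> j)))
        = (\<Sum>j\<in>{s..<n}. w j * (1 - \<theta> j ^ (Suc n - j - 1)))"
      unfolding sum.distrib[symmetric]
    proof (intro sum.cong refl)
      fix j assume "j \<in> {s..<n}"
      then have "\<theta> j ^ (Suc n - j - 1) = \<theta> j * \<theta> j ^ (n - j - 1)"
        by (simp add: Suc_diff_Suc flip: power_Suc)
      then show "w j * (1 - \<theta> j ^ (n - j - 1)) + w j * (\<theta> j ^ (n - j - 1) * (1 - \<theta> j))
          = w j * (1 - \<theta> j ^ (Suc n - j - 1))"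
        by (simp add: algebra_simps)
    qed
    with True Suc show ?thesis by simp
  next
    case False
    then show ?thesis by simp
  qed
qed

text \<open>
  This is the correlation estimate that the second-moment form of the Borel-Cantelli lemma asks for:
  of the three terms of the two-point bound, the first sums to at most the square of the total exit
  probability, the second to at most this total, and the third to at most three times this total.
\<close>

lemma sum_two_point_bound:
  fixes q :: "nat \<Rightarrow> real"
  assumes mono: "mono q" and q: "\<And>k. 0 \<le> q k" "\<And>k. q k \<le> 1"
  shows "(\<Sum>k\<in>{s..<n}. \<Sum>j\<in>{s..<k}. q j ^ j * q k ^ (k - j - 1) * (q k - q j) * (1 - q k))
      \<le> (\<Sum>k\<in>{s..<n}. q k ^ k * (1 - q k))\<^sup>2 + 4 * (\<Sum>k\<in>{s..<n}. q k ^ k * (1 - q k))"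
proof -
  define p where "p k = q k ^ k * (1 - q k)" for k
  define \<theta> where "\<theta> j = 1 - 1 / (2 * real (Suc j))" for j
  define S where "S = (\<Sum>k\<in>{s..<n}. p k)"
  have p0: "0 \<le> p k" for k using q[of k] by (simp add: p_def)
  have \<theta>0: "0 \<le> \<theta> j" for j by (simp add: \<theta>_def field_simps)
  have "(\<Sum>k\<in>{s..<n}. \<Sum>j\<in>{s..<k}. q j ^ j * q k ^ (k - j - 1) * (q k - q j) * (1 - q k))
      \<le> (\<Sum>k\<in>{s..<n}. \<Sum>j\<in>{s..<k}. 2 * (p j * p k) + p j * (\<theta> j ^ (k - j - 1) * (1 - \<theta> j))
            + 3 / real (Suc k) * p k)"
    unfolding p_def
    by (intro sum_mono two_point_bound) (use mono q in \<open>auto simp: \<theta>_def intro: monoD\<close>)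
  also have "\<dots> = 2 * (\<Sum>k\<in>{s..<n}. \<Sum>j\<in>{s..<k}. p j * p k)
      + (\<Sum>k\<in>{s..<n}. \<Sum>j\<in>{s..<k}. p j * (\<theta> j ^ (k - j - 1) * (1 - \<theta> j)))
      + (\<Sum>k\<in>{s..<n}. \<Sum>j\<in>{s..<k}. 3 / real (Suc k) * p k)"
    by (simp only: sum.distrib sum_distrib_left)
  also have "2 * (\<Sum>k\<in>{s..<n}. \<Sum>j\<in>{s..<k}. p j * p k) \<le> S\<^sup>2"
  proof -
    have "S\<^sup>2 = (\<Sum>i\<in>{s..<n}. \<Sum>j\<in>{s..<n}. p i * p j)"
      unfolding S_def power2_eq_square sum_product ..
    also have "\<dots> = (\<Sum>k\<in>{s..<n}. p k * p k) + 2 * (\<Sum>k\<in>{s..<n}. \<Sum>j\<in>{s..<k}. p j * p k)"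
      by (rule sum_symmetric_split) simp
    finally show ?thesis using p0 by (simp add: sum_nonneg)
  qed
  also have "(\<Sum>k\<in>{s..<n}. \<Sum>j\<in>{s..<k}. p j * (\<theta> j ^ (k - j - 1) * (1 - \<theta> j))) \<le> S"
    unfolding sum_geometric_kernel S_def
    using p0 \<theta>0 by (intro sum_mono mult_left_le) auto
  also have "(\<Sum>k\<in>{s..<n}. \<Sum>j\<in>{s..<k}. 3 / real (Suc k) * p k) \<le> 3 * S"
    unfolding S_def sum_distrib_left
  proof (intro sum_mono)
    fix k
    have "real (k - s) * (3 / real (Suc k)) \<le> 3" by (simp add: field_simps)
    then have "real (k - s) * (3 / real (Suc k)) * p k \<le> 3 * p k"
      using p0 by (intro mult_right_mono) auto
    then show "(\<Sum>j\<in>{s..<k}. 3 / real (Suc k) * p k) \<le> 3 * p k" by simp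
  qed
  finally show ?thesis by (simp add: S_def p_def)
qed

section \<open>The integral test\<close>

text \<open>
  The function \<open>x * exp (- t * x)\<close> decreases for \<open>x \<ge> 1 / t\<close>.  This is where a diverging product
  \<open>t * g t\<close> enters: it makes the integrand of \<open>J\<close> a decreasing function of \<open>g\<close>, so that monotonicity of
  \<open>g\<close> gives one-sided comparisons on unit intervals, however fast \<open>g\<close> drops there.
\<close>

lemma times_exp_antimono:
  fixes t x y :: real
  assumes "1 \<le> t * x" "0 \<le> t" "x \<le> y"
  shows "y * exp (- t * y) \<le> x * exp (- t * x)"
proof -
  have x: "x > 0" using assms by (smt (verit) mult_nonneg_nonpos)
  have "y - x \<le> (t * x) * (y - x)" using assms mult_right_mono[of 1 "t * x" "y - x"] by simp
  then have "y \<le> x * (1 + t * (y - x))" by (simp add: algebra_simps)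
  also have "\<dots> \<le> x * exp (t * (y - x))"
    using x by (intro mult_left_mono exp_ge_add_one_self) auto
  finally have "y * exp (- t * y) \<le> x * exp (t * (y - x)) * exp (- t * y)"
    by (rule mult_right_mono) simp
  also have "\<dots> = x * exp (- t * x)"
    by (simp add: algebra_simps flip: exp_add)
  finally show ?thesis .
qed

lemma nn_integral_unit_steps:
  fixes c :: "nat \<Rightarrow> ennreal"
  shows "(\<integral>\<^sup>+ t. c (nat \<lfloor>t\<rfloor>) * indicator {0::real..} t \<partial>lborel) = (\<Sum>k. c k)"
proof -
  have disj: "disjoint_family (\<lambda>k::nat. {real k..<real k + 1})"
    by (auto simp: disjoint_family_on_def)
  have "c (nat \<lfloor>t\<rfloor>) * indicator {0..} t = (\<Sum>k. c k * indicator {real k..<real k + 1} t)" for t :: real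
  proof (cases "t \<ge> 0")
    case True
    then have "t \<in> {real (nat \<lfloor>t\<rfloor>)..<real (nat \<lfloor>t\<rfloor>) + 1}" by simp
    from suminf_cmult_indicator[OF disj this] True show ?thesis by simp
  next
    case False
    then have "indicator {real k..<real k + 1} t = (0::ennreal)" for k by auto
    with False show ?thesis by simp
  qed
  then have "(\<integral>\<^sup>+ t. c (nat \<lfloor>t\<rfloor>) * indicator {0::real..} t \<partial>lborel)
      = (\<integral>\<^sup>+ t. (\<Sum>k. c k * indicator {real k..<real k + 1} (t::real)) \<partial>lborel)"
    by (intro nn_integral_cong)
  also have "\<dots> = (\<Sum>k. \<integral>\<^sup>+ t. c k * indicator {real k..<real k + 1} t \<partial>lborel)"
    by (rule nn_integral_suminf) simp
  finally show ?thesis by (simp add: nn_integral_cmult)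
qed

text \<open>
  On \<open>{k + 1..<k + 2}\<close> one has \<open>g t \<le> g (k + 1)\<close>, so monotonicity in \<open>g\<close> bounds the integrand from
  below by its value with \<open>g (k + 1)\<close> in place of \<open>g t\<close>.  The exponent \<open>k\<close> instead of \<open>k + 1\<close> leaves
  room for the difference between the time and the level in the discretised boundary crossing event.
\<close>

lemma summable_of_J_integral_finite:
  fixes g :: "real \<Rightarrow> real"
  assumes anti: "antimono_on {0..} g" and g: "\<And>t. 0 \<le> g t" "\<And>t. g t \<le> 1"
    and lim: "filterlim (\<lambda>t. t * g t) at_top at_top" and J: "J_integral g < \<infinity>"
  shows "summable (\<lambda>k. g (real (Suc k)) * exp (- real k * g (real (Suc k))))"
proof -
  obtain K0 where K0: "\<And>t. t \<ge> K0 \<Longrightarrow> t * g t \<ge> 1"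
    using filterlim_at_top[THEN iffD1, OF lim, rule_format, of 1] unfolding eventually_at_top_linorder by auto
  define K where "K = nat \<lceil>K0\<rceil>"
  have K: "t * g t \<ge> 1" if "t \<ge> real K" for t
    using that by (intro K0) (simp add: K_def, linarith)
  define a where "a k = g (real k) * exp (- (real k - 1) * g (real k))" for k
  define c where "c k = (if k \<ge> K then exp (-2) * a k else 0)" for k
  have c0: "0 \<le> c k" for k using g by (simp add: c_def a_def)
  have "(\<Sum>k. ennreal (c k)) = (\<integral>\<^sup>+ t. ennreal (c (nat \<lfloor>t\<rfloor>)) * indicator {0::real..} t \<partial>lborel)"
    by (rule nn_integral_unit_steps[symmetric])
  also have "\<dots> \<le> J_integral g"
    unfolding J_integral_def
  proof (rule nn_integral_mono)
    fix t
    show "ennreal (c (nat \<lfloor>t\<rfloor>)) * indicator {0..} t \<le> ennreal (g t * exp (- t * g t)) * indicator {0..} t"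
    proof (cases "t \<ge> 0 \<and> nat \<lfloor>t\<rfloor> \<ge> K")
      case True
      define k where "k = nat \<lfloor>t\<rfloor>"
      have k: "real k \<le> t" "t < real k + 1" "k \<ge> K" using True unfolding k_def by linarith+
      have gk: "g t \<le> g (real k)" using anti True k by (auto simp: monotone_on_def)
      have "exp (-2) * a k = g (real k) * exp (- 2 - (real k - 1) * g (real k))"
        by (simp add: a_def exp_diff exp_minus divide_inverse algebra_simps exp_add)
      also have "\<dots> \<le> g (real k) * exp (- t * g (real k))"
      proof (intro mult_left_mono iffD2[OF exp_le_cancel_iff])
        have "(t - (real k - 1)) * g (real k) \<le> 2 * 1"
          using k g by (intro mult_mono) auto
        then show "- 2 - (real k - 1) * g (real k) \<le> - t * g (real k)"
          by (simp add: algebra_simps)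
      qed (use g in auto)
      also have "\<dots> \<le> g t * exp (- t * g t)"
        using gk K[of t] k True by (intro times_exp_antimono) auto
      finally show ?thesis
        using True by (auto simp: c_def k_def intro!: ennreal_leI)
    next
      case False
      then show ?thesis by (auto simp: c_def)
    qed
  qed
  also note J
  finally have "summable c" using c0 by (intro summable_suminf_not_top) auto
  then have "summable (\<lambda>k. exp 2 * c (Suc k))" by (subst (asm) summable_Suc_iff[symmetric]) (rule summable_mult)
  moreover have "\<forall>\<^sub>F k in sequentially. exp 2 * c (Suc k) = a (Suc k)"
    using eventually_ge_at_top[of K]
    by eventually_elim (simp add: c_def flip: exp_add mult.assoc)
  ultimately have "summable (\<lambda>k. a (Suc k))" by (simp cong: summable_cong)
  then show ?thesis by (simp add: a_def)
qed

text \<open>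
  Now the right endpoint serves as comparison point: on \<open>{k..<k + 1}\<close> one has \<open>g t \<ge> g (k + 1)\<close>.
\<close>

lemma not_summable_of_J_integral_infinite:
  fixes g :: "real \<Rightarrow> real"
  assumes anti: "antimono_on {0..} g" and g: "\<And>t. 0 \<le> g t" "\<And>t. g t \<le> 1"
    and lim: "filterlim (\<lambda>t. t * g t) at_top at_top" and J: "J_integral g = \<infinity>"
  shows "\<not> summable (\<lambda>k. g (real k) * exp (- real k * g (real k)))"
proof
  define a where "a k = g (real k) * exp (- real k * g (real k))" for k
  assume "summable (\<lambda>k. g (real k) * exp (- real k * g (real k)))"
  then have sum_a: "summable a" by (simp add: a_def[abs_def])
  obtain K0 where K0: "\<And>t. t \<ge> K0 \<Longrightarrow> t * g t \<ge> 2"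
    using filterlim_at_top[THEN iffD1, OF lim, rule_format, of 2] unfolding eventually_at_top_linorder by auto
  define K where "K = Suc (nat \<lceil>K0\<rceil>)"
  have K: "t * g t \<ge> 2" if "t \<ge> real K" for t
    using that by (intro K0) (simp add: K_def, linarith)
  \<comment> \<open>Before \<open>K\<close> the integrand is only known to be at most \<open>1\<close>.\<close>
  define c where "c k = (if k < K then 1 else exp 1 * a (Suc k))" for k
  have c0: "0 \<le> c k" for k using g by (simp add: c_def a_def)
  have "\<forall>\<^sub>F k in sequentially. exp 1 * a (Suc k) = c k"
    using eventually_ge_at_top[of K] by eventually_elim (simp add: c_def)
  moreover have "summable (\<lambda>k. exp 1 * a (Suc k))"
    using sum_a by (intro summable_mult) (simp add: summable_Suc_iff)
  ultimately have "summable c" by (simp cong: summable_cong)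
  then have "(\<Sum>k. ennreal (c k)) = ennreal (\<Sum>k. c k)" using c0 by (intro suminf_ennreal2) auto
  also have "\<dots> < \<infinity>" by simp
  finally have fin: "(\<Sum>k. ennreal (c k)) < \<infinity>" .
  have "J_integral g \<le> (\<integral>\<^sup>+ t. ennreal (c (nat \<lfloor>t\<rfloor>)) * indicator {0::real..} t \<partial>lborel)"
    unfolding J_integral_def
  proof (rule nn_integral_mono)
    fix t
    show "ennreal (g t * exp (- t * g t)) * indicator {0..} t \<le> ennreal (c (nat \<lfloor>t\<rfloor>)) * indicator {0..} t"
    proof (cases "t \<ge> 0")
      case t: True
      define k where "k = nat \<lfloor>t\<rfloor>"
      have k: "real k \<le> t" "t < real k + 1" using t unfolding k_def by linarith+
      have "g t * exp (- t * g t) \<le> c k"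
      proof (cases "k < K")
        case True
        have "g t * exp (- t * g t) \<le> 1 * 1" using g t by (intro mult_mono) auto
        then show ?thesis using True by (simp add: c_def)
      next
        case False
        define h where "h = g (real (Suc k))"
        have h: "0 \<le> h" "h \<le> 1" using g by (auto simp: h_def)
        have "2 \<le> real (Suc k) * h" using K[of "real (Suc k)"] False by (simp add: h_def)
        also have "real (Suc k) * h \<le> (2 * t) * h"
          using k False h by (intro mult_right_mono) (auto simp: K_def)
        finally have th: "1 \<le> t * h" by simp
        have "h \<le> g t" using anti t k by (auto simp: monotone_on_def h_def)
        then have "g t * exp (- t * g t) \<le> h * exp (- t * h)"
          using th t by (intro times_exp_antimono) auto
        also have "\<dots> \<le> h * exp (1 - real (Suc k) * h)"
        proof (intro mult_left_mono iffD2[OF exp_le_cancel_iff])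
          have "(real (Suc k) - t) * h \<le> 1 * 1" using k h by (intro mult_mono) auto
          then show "- t * h \<le> 1 - real (Suc k) * h" by (simp add: algebra_simps)
        qed (use h in auto)
        also have "\<dots> = c k" using False by (simp add: c_def a_def h_def exp_diff exp_minus exp_add field_simps)
        finally show ?thesis .
      qed
      then show ?thesis by (auto simp: k_def intro!: mult_right_mono ennreal_leI)
    qed simp
  qed
  also have "\<dots> = (\<Sum>k. ennreal (c k))" by (rule nn_integral_unit_steps)
  finally show False using fin J by simp
qed

text \<open>
  As \<open>ln (1 - g) \<ge> - g - 2 * g\<^sup>2\<close>, the power \<open>(1 - g) ^ k\<close> and \<open>exp (- k * g)\<close> differ by a bounded
  factor as long as \<open>k * g\<^sup>2\<close> stays bounded.
\<close>

lemma exp_le_const_times_power: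
  fixes g :: real
  assumes g: "0 \<le> g" "g \<le> 1/2" and C: "real k * g\<^sup>2 \<le> C"
  shows "exp (- real k * g) \<le> exp (2 * C) * (1 - g) ^ k"
proof -
  have "- real k * g - 2 * C \<le> real k * (- g - 2 * g\<^sup>2)" using C by (simp add: algebra_simps)
  also have "\<dots> \<le> real k * ln (1 - g)"
    using g by (intro mult_left_mono ln_one_minus_pos_lower_bound) auto
  finally have "exp (- real k * g - 2 * C) \<le> exp (real k * ln (1 - g))" by simp
  also have "\<dots> = (1 - g) ^ k" using g by (simp add: exp_of_nat_mult)
  finally have "exp (2 * C) * exp (- real k * g - 2 * C) \<le> exp (2 * C) * (1 - g) ^ k" by simp
  then show ?thesis by (simp flip: exp_add)
qed

text \<open>
  Where \<open>k * g\<^sup>2\<close> exceeds \<open>1\<close>, \<open>k * g\<close> exceeds \<open>sqrt k\<close>, and the exponential alone makes the term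
  smaller than a multiple of \<open>1 / k\<^sup>2\<close>.  So \<open>exp (- k * g)\<close> may replace \<open>(1 - g) ^ k\<close> without a rate
  of convergence for \<open>g\<close>.
\<close>

lemma summable_exp_of_summable_power:
  fixes g :: "nat \<Rightarrow> real"
  assumes g: "\<And>k. 0 \<le> g k" and lim: "g \<longlonglongrightarrow> 0"
    and sum: "summable (\<lambda>k. g k * (1 - g k) ^ k)"
  shows "summable (\<lambda>k. g k * exp (- real k * g k))"
proof (rule summable_comparison_test_ev)
  show "summable (\<lambda>k. exp 2 * (g k * (1 - g k) ^ k) + 256 * (1 / real k ^ 2))"
    using sum inverse_power_summable[of 2, where 'a = real]
    by (intro summable_add summable_mult) (simp_all add: field_simps)
  have "\<forall>\<^sub>F k in sequentially. g k < 1/2" using lim by (rule order_tendstoD) simp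
  then show "\<forall>\<^sub>F k in sequentially. norm (g k * exp (- real k * g k))
      \<le> exp 2 * (g k * (1 - g k) ^ k) + 256 * (1 / real k ^ 2)"
    using eventually_gt_at_top[of 0]
  proof eventually_elim
    fix k :: nat assume k: "0 < k" and gk: "g k < 1/2"
    have nonneg: "0 \<le> g k * (1 - g k) ^ k" using g[of k] gk by simp
    show "norm (g k * exp (- real k * g k))
      \<le> exp 2 * (g k * (1 - g k) ^ k) + 256 * (1 / real k ^ 2)"
    proof (cases "real k * (g k)\<^sup>2 \<le> 1")
      case True
      then have "g k * exp (- real k * g k) \<le> g k * (exp (2 * 1) * (1 - g k) ^ k)"
        using g[of k] gk by (intro mult_left_mono exp_le_const_times_power) auto
      also have "\<dots> = exp 2 * (g k * (1 - g k) ^ k)" by simp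
      finally show ?thesis using g[of k] by (simp add: add_increasing2)
    next
      case False
      define y where "y = real k * g k"
      have "real k * 1 \<le> real k * (real k * (g k)\<^sup>2)" using False by (intro mult_left_mono) auto
      then have y: "real k \<le> y ^ 2" by (simp add: y_def power2_eq_square algebra_simps)
      have y0: "y > 0" using g[of k] False k by (cases "g k = 0") (auto simp: y_def)
      \<comment> \<open>The fourth power turns \<open>y\<^sup>2 \<ge> k\<close> into the summable bound \<open>1 / k\<^sup>2\<close>.\<close>
      have "(y / 4) ^ 4 \<le> exp (y / 4) ^ 4"
        using y0 exp_ge_add_one_self[of "y / 4"] by (intro power_mono) linarith+
      also have "\<dots> = exp y" by (simp flip: exp_of_nat_mult)
      finally have "exp (- y) \<le> 256 / y ^ 4" using y0 by (simp add: exp_minus field_simps)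
      also have "\<dots> \<le> 256 / real k ^ 2"
        using power_mono[OF y, of 2] k y0 by (intro divide_left_mono) (auto simp flip: power_mult)
      finally have "exp (- y) \<le> 256 * (1 / real k ^ 2)" by simp
      moreover have "g k * exp (- y) \<le> 1 * exp (- y)" using gk by (intro mult_right_mono) auto
      ultimately have "g k * exp (- y) \<le> 256 * (1 / real k ^ 2)" by linarith
      then show ?thesis using nonneg g[of k] by (simp add: y_def add_increasing)
    qed
  qed
qed

section \<open>Void events\<close>

context poisson_point_process
begin

definition void :: "'a set \<Rightarrow> 'w set" where
  "void S = {\<omega> \<in> space \<Omega>. emeasure (N \<omega>) S = 0}"

lemma sets_void [measurable]:
  assumes "S \<in> sets \<Lambda>"
  shows "void S \<in> events"
  unfolding void_def using random_count[OF assms] by measurable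

lemma void_Un:
  assumes "A \<in> sets \<Lambda>" "B \<in> sets \<Lambda>"
  shows "void (A \<union> B) = void A \<inter> void B"
proof -
  have "emeasure (N \<omega>) (A \<union> B) = 0 \<longleftrightarrow> emeasure (N \<omega>) A = 0 \<and> emeasure (N \<omega>) B = 0"
    if "\<omega> \<in> space \<Omega>" for \<omega>
  proof
    assume "emeasure (N \<omega>) (A \<union> B) = 0"
    then show "emeasure (N \<omega>) A = 0 \<and> emeasure (N \<omega>) B = 0"
      using emeasure_mono[of A "A \<union> B" "N \<omega>"] emeasure_mono[of B "A \<union> B" "N \<omega>"]
        assms sets_realization[OF that] by simp
  next
    assume "emeasure (N \<omega>) A = 0 \<and> emeasure (N \<omega>) B = 0"
    then show "emeasure (N \<omega>) (A \<union> B) = 0"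
      using emeasure_subadditive[of A "N \<omega>" B] assms sets_realization[OF that] by simp
  qed
  then show ?thesis by (auto simp: void_def)
qed

lemma void_antimono:
  assumes "A \<subseteq> B" "B \<in> sets \<Lambda>"
  shows "void B \<subseteq> void A"
proof
  fix \<omega> assume "\<omega> \<in> void B"
  then have \<omega>: "\<omega> \<in> space \<Omega>" "emeasure (N \<omega>) B = 0" by (auto simp: void_def)
  have "emeasure (N \<omega>) A \<le> emeasure (N \<omega>) B"
    using assms sets_realization[OF \<omega>(1)] by (intro emeasure_mono) auto
  with \<omega> show "\<omega> \<in> void A" by (simp add: void_def)
qed

lemma void_empty [simp]: "void {} = space \<Omega>"
  by (simp add: void_def)

lemma void_subset_space: "void S \<subseteq> space \<Omega>"
  by (auto simp: void_def)

lemma prob_void_finite: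
  assumes "S \<in> sets \<Lambda>" "emeasure \<Lambda> S < \<infinity>"
  shows "prob (void S) = exp (- measure \<Lambda> S)"
  using poisson_finite[OF assms, of 0] by (simp add: void_def)

lemma prob_void_infinite:
  assumes "S \<in> sets \<Lambda>" "emeasure \<Lambda> S = \<infinity>"
  shows "prob (void S) = 0"
proof -
  have "AE \<omega> in \<Omega>. \<omega> \<notin> void S"
    using poisson_infinite[OF assms] by eventually_elim (auto simp: void_def)
  then show ?thesis using assms by (subst prob_eq_0) auto
qed

text \<open>
  Counts over disjoint sets are independent, and a void event is the preimage of \<open>{0}\<close> under a count.
\<close>

lemma prob_void_INT:
  fixes S :: "nat \<Rightarrow> 'a set"
  assumes J: "finite J" "J \<noteq> {}" and S: "\<And>j. j \<in> J \<Longrightarrow> S j \<in> sets \<Lambda>"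
    and disj: "disjoint_family_on S J"
  shows "prob (\<Inter>j\<in>J. void (S j)) = (\<Prod>j\<in>J. prob (void (S j)))"
proof -
  have "indep_vars (\<lambda>_. borel) (\<lambda>j \<omega>. emeasure (N \<omega>) (S j)) J"
    using J S disj by (intro independent_counts) auto
  then have "indep_sets (\<lambda>j. {(\<lambda>\<omega>. emeasure (N \<omega>) (S j)) -` B \<inter> space \<Omega> | B. B \<in> sets borel}) J"
    unfolding indep_vars_def2 by simp
  then show ?thesis
  proof (rule indep_setsD)
    show "\<forall>j\<in>J. void (S j) \<in> {(\<lambda>\<omega>. emeasure (N \<omega>) (S j)) -` B \<inter> space \<Omega> | B. B \<in> sets borel}"
    proof
      fix j
      have "void (S j) = (\<lambda>\<omega>. emeasure (N \<omega>) (S j)) -` {0} \<inter> space \<Omega>" by (auto simp: void_def)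
      then show "void (S j) \<in> {(\<lambda>\<omega>. emeasure (N \<omega>) (S j)) -` B \<inter> space \<Omega> | B. B \<in> sets borel}"
        by (intro CollectI exI[of _ "{0}"]) simp
    qed
  qed (use J in auto)
qed

lemma prob_void_Int:
  assumes "A \<in> sets \<Lambda>" "B \<in> sets \<Lambda>" "A \<inter> B = {}"
  shows "prob (void A \<inter> void B) = prob (void A) * prob (void B)"
proof -
  define S where "S = (\<lambda>i::nat. if i = 0 then A else B)"
  have "prob (\<Inter>j\<in>{0, 1}. void (S j)) = (\<Prod>j\<in>{0, 1}. prob (void (S j)))"
    using assms by (intro prob_void_INT) (auto simp: S_def disjoint_family_on_def)
  then show ?thesis by (simp add: S_def)
qed

lemma prob_void_Diff:
  assumes "A \<in> sets \<Lambda>" "B \<in> sets \<Lambda>" "A \<inter> B = {}"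
  shows "prob (void A - void B) = prob (void A) * (1 - prob (void B))"
proof -
  have "prob (void A - void B) = prob (void A) - prob (void A \<inter> void B)"
    using assms by (intro finite_measure_Diff') auto
  then show ?thesis by (simp add: prob_void_Int[OF assms] right_diff_distrib)
qed

text \<open>
  Void events are stable under intersection, so independence over disjoint slabs passes from them to
  the generated sigma-algebras, and Kolmogorov's law applies to tail events expressed through voids.
\<close>

lemma void_zero_one_law:
  fixes R :: "nat \<Rightarrow> 'a set"
  assumes disj: "disjoint_family R"
    and X: "\<And>n. X \<in> sigma_sets (space \<Omega>) (\<Union>i\<in>{n..}. {void S | S. S \<in> sets \<Lambda> \<and> S \<subseteq> R i})"
  shows "prob X = 0 \<or> prob X = 1"
proof -
  define G where "G i = {void S | S. S \<in> sets \<Lambda> \<and> S \<subseteq> R i}" for i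
  have G_space: "G i \<subseteq> Pow (space \<Omega>)" for i by (auto simp: G_def void_def)
  have "indep_sets G UNIV"
  proof (rule indep_setsI)
    show "G i \<subseteq> events" for i by (auto simp: G_def)
    fix A :: "nat \<Rightarrow> 'w set" and J :: "nat set"
    assume J: "J \<noteq> {}" "finite J" and A: "\<forall>j\<in>J. A j \<in> G j"
    from A have "\<forall>j\<in>J. \<exists>S. A j = void S \<and> S \<in> sets \<Lambda> \<and> S \<subseteq> R j" by (auto simp: G_def)
    then obtain S where S: "\<And>j. j \<in> J \<Longrightarrow> A j = void (S j) \<and> S j \<in> sets \<Lambda> \<and> S j \<subseteq> R j" by metis
    have "disjoint_family_on S J"
      using disj S unfolding disjoint_family_on_def by blast
    then have "prob (\<Inter>j\<in>J. void (S j)) = (\<Prod>j\<in>J. prob (void (S j)))"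
      using J S by (intro prob_void_INT) auto
    then show "prob (\<Inter>j\<in>J. A j) = (\<Prod>j\<in>J. prob (A j))" using S by simp
  qed
  moreover have "Int_stable (G i)" for i
  proof (rule Int_stableI)
    fix a b assume "a \<in> G i" "b \<in> G i"
    then obtain S T where "a = void S" "S \<in> sets \<Lambda>" "S \<subseteq> R i" "b = void T" "T \<in> sets \<Lambda>" "T \<subseteq> R i"
      by (auto simp: G_def)
    then have "a \<inter> b = void (S \<union> T) \<and> S \<union> T \<in> sets \<Lambda> \<and> S \<union> T \<subseteq> R i" by (auto simp: void_Un)
    then show "a \<inter> b \<in> G i" unfolding G_def by blast
  qed
  ultimately have indep: "indep_sets (\<lambda>i. sigma_sets (space \<Omega>) (G i)) UNIV"
    by (rule indep_sets_sigma)
  show ?thesis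
  proof (rule kolmogorov_0_1_law[OF _ indep])
    show "sigma_algebra (space \<Omega>) (sigma_sets (space \<Omega>) (G i))" for i
      by (rule sigma_algebra_sigma_sets[OF G_space])
    have "sigma_sets (space \<Omega>) (\<Union>i\<in>{n..}. G i)
        \<subseteq> sigma_sets (space \<Omega>) (\<Union>i\<in>{n..}. sigma_sets (space \<Omega>) (G i))" for n
      by (rule sigma_sets_subseteq) auto
    then show "X \<in> tail_events (\<lambda>i. sigma_sets (space \<Omega>) (G i))"
      using X unfolding tail_events_def G_def by blast
  qed
qed

end

section \<open>Strips above a level\<close>

text \<open>
  All levels are tested at integer times, so a strip has integer end points in time; for \<open>m = n\<close> it is
  empty.
\<close>

abbreviation strip :: "nat \<Rightarrow> nat \<Rightarrow> real \<Rightarrow> (real \<times> real) set" where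
  "strip m n x \<equiv> {real m<..real n} \<times> {x<..}"

locale extremal_point_process = poisson_point_process \<Omega> N \<Lambda>
  for \<Omega> :: "'w measure" and N :: "'w \<Rightarrow> (real \<times> real) measure" and \<Lambda> :: "(real \<times> real) measure" +
  fixes D :: "real measure" and F :: "real \<Rightarrow> real"
  assumes D: "real_distribution D" and F_cdf: "F = cdf D"
    and endpoint: "\<And>x. lower_endpoint F = ereal x \<Longrightarrow> F x = 0"
    and intensity: "extremal_intensity F \<Lambda>"
begin

lemma F_mono: "x \<le> y \<Longrightarrow> F x \<le> F y"
  and F_nonneg [simp]: "0 \<le> F x"
  and F_le_1 [simp]: "F x \<le> 1"
proof -
  interpret D: real_distribution D by (rule D)
  show "x \<le> y \<Longrightarrow> F x \<le> F y" by (simp add: F_cdf D.cdf_nondecreasing)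
  show "0 \<le> F x" by (simp add: F_cdf D.cdf_nonneg)
  show "F x \<le> 1" by (simp add: F_cdf D.cdf_bounded_prob)
qed

lemma sets_Times [simp, measurable]: "{a<..b} \<times> {x<..} \<in> sets \<Lambda>" for a b x :: real
  using intensity by (simp add: extremal_intensity_def borel_Times)

text \<open>
  No mass at the left endpoint makes the inequality strict.
\<close>

lemma F_pos_iff: "F x > 0 \<longleftrightarrow> lower_endpoint F < ereal x"
proof
  assume pos: "F x > 0"
  then have "lower_endpoint F \<le> ereal x" unfolding lower_endpoint_def by (intro Inf_lower) auto
  moreover have "lower_endpoint F \<noteq> ereal x" using endpoint pos by force
  ultimately show "lower_endpoint F < ereal x" by simp
next
  assume "lower_endpoint F < ereal x"
  then obtain y where "F y > 0" "y < x" by (auto simp: lower_endpoint_def Inf_less_iff)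
  then show "F x > 0" using F_mono[of y x] by simp
qed

text \<open>
  The intensity is given on open time intervals; \<open>{a<..b}\<close> is squeezed between \<open>{a<..<b}\<close> and the
  intervals \<open>{a<..<b + 1 / (n + 1)}\<close>.
\<close>

lemma emeasure_half_open_strip:
  assumes "a < b" "F x > 0"
  shows "emeasure \<Lambda> ({a<..b} \<times> {x<..}) = ennreal ((b - a) * (- ln (F x)))"
proof (rule antisym)
  have sets_eq: "sets \<Lambda> = sets borel"
    and eq: "emeasure \<Lambda> ({a<..<c} \<times> {x<..}) = ennreal ((c - a) * (- ln (F x)))" if "a < c" for c
    using intensity F_pos_iff[of x] assms that by (auto simp: extremal_intensity_def algebra_simps)
  have sets: "{a<..<c} \<times> {x<..} \<in> sets \<Lambda>" for c
    using sets_eq[OF assms(1)] by (simp add: borel_Times)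
  show "ennreal ((b - a) * (- ln (F x))) \<le> emeasure \<Lambda> ({a<..b} \<times> {x<..})"
    unfolding eq[OF assms(1), symmetric] by (intro emeasure_mono) auto
  have "(\<lambda>n. ennreal ((b + inverse (real (Suc n)) - a) * (- ln (F x))))
      \<longlonglongrightarrow> ennreal ((b + 0 - a) * (- ln (F x)))"
    by (intro tendsto_ennrealI tendsto_intros LIMSEQ_inverse_real_of_nat)
  moreover have "emeasure \<Lambda> ({a<..b} \<times> {x<..}) \<le> ennreal ((b + inverse (real (Suc n)) - a) * (- ln (F x)))" for n
  proof -
    define e where "e = inverse (real (Suc n))"
    have e: "e > 0" by (simp add: e_def)
    have "emeasure \<Lambda> ({a<..b} \<times> {x<..}) \<le> emeasure \<Lambda> ({a<..<b + e} \<times> {x<..})"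
      using sets e by (intro emeasure_mono) auto
    also have "\<dots> = ennreal ((b + e - a) * (- ln (F x)))"
      using assms e by (intro eq) linarith
    also have "\<dots> = ennreal ((b + inverse (real (Suc n)) - a) * (- ln (F x)))"
      by (simp only: e_def)
    finally show ?thesis .
  qed
  ultimately show "emeasure \<Lambda> ({a<..b} \<times> {x<..}) \<le> ennreal ((b - a) * (- ln (F x)))"
    by (metis (lifting) LIMSEQ_le_const add.right_neutral)
qed

text \<open>
  At and below the left endpoint \<open>F\<close> vanishes and \<open>- ln (F y)\<close> explodes as \<open>y\<close> decreases to the
  endpoint, so every strip carries infinitely many points.
\<close>

lemma emeasure_half_open_strip_infinite:
  assumes "a < b" "F x = 0"
  shows "emeasure \<Lambda> ({a<..b} \<times> {x<..}) = \<infinity>"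
proof -
  interpret D: real_distribution D by (rule D)
  have "\<forall>\<^sub>F y in at_top. F y > 0"
    unfolding F_cdf using D.cdf_lim_at_top_prob by (rule order_tendstoD) simp
  then obtain z where "F z > 0" by (auto simp: eventually_at_top_linorder)
  then have "lower_endpoint F < ereal z" by (simp add: F_pos_iff)
  moreover have x_le: "ereal x \<le> lower_endpoint F" using F_pos_iff[of x] assms by simp
  ultimately obtain x0 where x0: "lower_endpoint F = ereal x0" by (cases "lower_endpoint F") auto
  have "(F \<longlongrightarrow> F x0) (at_right x0)"
    using D.cdf_is_right_cont[of x0] by (simp add: F_cdf continuous_within)
  then have lim: "(F \<longlongrightarrow> 0) (at_right x0)" using endpoint x0 by simp
  have ge: "ennreal K \<le> emeasure \<Lambda> ({a<..b} \<times> {x<..})" if "K \<ge> 0" for K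
  proof -
    have "\<forall>\<^sub>F y in at_right x0. F y < exp (- K / (b - a)) \<and> x0 < y"
      by (intro eventually_conj order_tendstoD(2)[OF lim] eventually_at_right_less) simp
    then obtain y where y: "F y < exp (- K / (b - a))" "x0 < y"
      using eventually_happens'[OF trivial_limit_at_right_real] by blast
    have pos: "F y > 0" using y x0 by (simp add: F_pos_iff)
    have "ln (F y) < ln (exp (- K / (b - a)))" using y pos by (subst ln_less_cancel_iff) auto
    then have "K \<le> (b - a) * (- ln (F y))" using assms by (simp add: field_simps)
    then have "ennreal K \<le> ennreal ((b - a) * (- ln (F y)))" by (rule ennreal_leI)
    also have "\<dots> = emeasure \<Lambda> ({a<..b} \<times> {y<..})"
      using assms pos by (simp add: emeasure_half_open_strip)
    also have "\<dots> \<le> emeasure \<Lambda> ({a<..b} \<times> {x<..})"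
      using y x_le x0 by (intro emeasure_mono) auto
    finally show ?thesis .
  qed
  show ?thesis
  proof (rule ccontr)
    assume "\<not> ?thesis"
    then obtain k :: nat where "emeasure \<Lambda> ({a<..b} \<times> {x<..}) < of_nat k"
      using ennreal_Ex_less_of_nat by (auto simp: less_top)
    then show False using ge[of "real k"] by (simp add: ennreal_of_nat_eq_real_of_nat)
  qed
qed

text \<open>
  The distribution of the maximum over a time interval of length \<open>n - m\<close>.  The convention \<open>0 ^ 0 = 1\<close>
  fits the empty strip, so the formula needs no case distinction later.
\<close>

lemma prob_void_strip:
  assumes "m \<le> n"
  shows "prob (void (strip m n x)) = F x ^ (n - m)"
proof (cases "m = n")
  case True
  then show ?thesis by (simp add: prob_space)
next
  case False
  then have mn: "real m < real n" using assms by simp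
  show ?thesis
  proof (cases "F x = 0")
    case True
    then show ?thesis
      using emeasure_half_open_strip_infinite[OF mn True] False assms
      by (subst prob_void_infinite) (auto simp: zero_power)
  next
    case False
    then have pos: "F x > 0" using F_nonneg[of x] by linarith
    have "0 \<le> (real n - real m) * (- ln (F x))" using mn pos by (intro mult_nonneg_nonneg) auto
    then have "prob (void (strip m n x)) = exp (real (n - m) * ln (F x))"
      using assms emeasure_half_open_strip[OF mn pos]
      by (subst prob_void_finite) (auto simp: measure_def of_nat_diff algebra_simps)
    also have "\<dots> = F x ^ (n - m)" using pos by (simp add: exp_of_nat_mult)
    finally show ?thesis .
  qed
qed

end

context extremal_point_process
begin

section \<open>Excursions below a boundary on the integers\<close>

text \<open>
  In terms of the extremal process, \<open>below c k\<close> is the event that its value at time \<open>k\<close> is at most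
  \<open>c k\<close>, see \<open>extremal_process_le_iff\<close>.  On \<open>exit c k\<close> this holds, but a point above \<open>c k\<close> follows
  during the next unit of time.  An excursion below the boundary may consist of many events
  \<open>below c k\<close> in a row; counting exits instead counts the excursion about once, which is what makes
  the sum of the probabilities decide.
\<close>

definition below :: "(nat \<Rightarrow> real) \<Rightarrow> nat \<Rightarrow> 'w set" where
  "below c k = void (strip 0 k (c k))"

definition exit :: "(nat \<Rightarrow> real) \<Rightarrow> nat \<Rightarrow> 'w set" where
  "exit c k = void (strip 0 k (c k)) - void (strip k (Suc k) (c k))"

lemma events_below [measurable, simp]: "below c k \<in> events"
  unfolding below_def by (intro sets_void sets_Times)

lemma events_exit [measurable, simp]: "exit c k \<in> events"
  unfolding exit_def by (intro sets.Diff sets_void sets_Times)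

lemma exit_subset_below: "exit c k \<subseteq> below c k"
  by (auto simp: exit_def below_def)

lemma void_strip_append:
  assumes "l \<le> m" "m \<le> n"
  shows "void (strip l n x) = void (strip l m x) \<inter> void (strip m n x)"
proof -
  have "strip l n x = strip l m x \<union> strip m n x" using assms by auto
  then show ?thesis by (simp only: void_Un[OF sets_Times sets_Times])
qed

lemma void_strip_mono:
  "l' \<le> l \<Longrightarrow> m \<le> m' \<Longrightarrow> x' \<le> x \<Longrightarrow> void (strip l' m' x') \<subseteq> void (strip l m x)"
  by (rule void_antimono) auto

lemma prob_below: "prob (below c k) = F (c k) ^ k"
  using prob_void_strip[of 0 k "c k"] by (simp add: below_def)

lemma prob_exit: "prob (exit c k) = F (c k) ^ k * (1 - F (c k))"
proof -
  have "prob (exit c k) = prob (void (strip 0 k (c k))) * (1 - prob (void (strip k (Suc k) (c k))))"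
    unfolding exit_def by (rule prob_void_Diff[OF sets_Times sets_Times]) auto
  then show ?thesis by (simp only: prob_void_strip) simp
qed

text \<open>
  The two excursions share points.  Cutting the union of the two regions at time \<open>j\<close> (at time
  \<open>j + 1\<close> if the strip of the first exit is included), where the lower level ceases to matter, writes it as a disjoint union of strips.
\<close>

lemma prob_exit_Int:
  assumes "mono c" "j < k"
  shows "prob (exit c j \<inter> exit c k)
    = F (c j) ^ j * F (c k) ^ (k - j - 1) * (F (c k) - F (c j)) * (1 - F (c k))"
proof -
  have cjk: "c j \<le> c k" using assms by (auto intro: monoD)
  define A where "A = strip 0 j (c j) \<union> strip j k (c k)"
  define B where "B = strip 0 (Suc j) (c j) \<union> strip (Suc j) k (c k)"
  define C where "C = strip k (Suc k) (c k)"
  have sets [simp]: "A \<in> sets \<Lambda>" "B \<in> sets \<Lambda>" "C \<in> sets \<Lambda>"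
    unfolding A_def B_def C_def by (intro sets.Un sets_Times)+
  have AB: "A \<subseteq> B" and AC: "A \<inter> C = {}" and BC: "B \<inter> C = {}"
    using assms(2) cjk by (auto simp: A_def B_def C_def)
  have A_eq: "A = strip 0 j (c j) \<union> strip 0 k (c k)"
    using assms(2) cjk by (auto simp: A_def)
  have B_eq: "B = A \<union> strip j (Suc j) (c j)"
    using assms(2) cjk unfolding A_def B_def by (intro set_eqI) auto
  have void_A: "void A = void (strip 0 j (c j)) \<inter> void (strip 0 k (c k))"
    unfolding A_eq by (rule void_Un[OF sets_Times sets_Times])
  have void_B: "void B = void A \<inter> void (strip j (Suc j) (c j))"
    unfolding B_eq by (rule void_Un[OF sets(1) sets_Times])
  have "exit c j \<inter> exit c k = (void A - void C) - (void B - void C)"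
    unfolding exit_def void_A void_B C_def by auto
  also have "prob \<dots> = prob (void A - void C) - prob (void B - void C)"
    using void_antimono[OF AB sets(2)] by (intro finite_measure_Diff sets.Diff sets_void sets(1-3)) blast
  also have "\<dots> = (prob (void A) - prob (void B)) * (1 - prob (void C))"
    using AC BC by (simp add: prob_void_Diff left_diff_distrib)
  also have "prob (void A) = F (c j) ^ j * F (c k) ^ (k - j)"
  proof -
    have "prob (void A) = prob (void (strip 0 j (c j))) * prob (void (strip j k (c k)))"
      unfolding A_def void_Un[OF sets_Times sets_Times]
      by (rule prob_void_Int[OF sets_Times sets_Times]) auto
    then show ?thesis using assms(2) by (simp only: prob_void_strip less_imp_le) simp
  qed
  also have "prob (void B) = F (c j) ^ Suc j * F (c k) ^ (k - Suc j)"
  proof -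
    have "prob (void B) = prob (void (strip 0 (Suc j) (c j))) * prob (void (strip (Suc j) k (c k)))"
      unfolding B_def void_Un[OF sets_Times sets_Times]
      by (rule prob_void_Int[OF sets_Times sets_Times]) auto
    then show ?thesis using assms(2) by (simp only: prob_void_strip Suc_leI) simp
  qed
  also have "prob (void C) = F (c k)"
    unfolding C_def by (subst prob_void_strip) auto
  also have "F (c k) ^ (k - j) = F (c k) * F (c k) ^ (k - j - 1)"
    using assms(2) by (simp flip: power_Suc add: Suc_diff_Suc)
  finally show ?thesis by (simp add: algebra_simps)
qed

text \<open>
  Finitely many exits occur by the first Borel-Cantelli lemma.  After the last one, a visit below the
  boundary could never end, since the boundary does not decrease; but staying below it forever has
  probability \<open>0\<close>.
\<close>

lemma AE_eventually_not_below:
  assumes mono: "mono c"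
    and sum: "summable (\<lambda>k. F (c k) ^ k * (1 - F (c k)))"
    and lim: "(\<lambda>k. F (c k) ^ k) \<longlonglongrightarrow> 0"
  shows "AE \<omega> in \<Omega>. \<forall>\<^sub>F k in sequentially. \<omega> \<notin> below c k"
proof -
  have "AE \<omega> in \<Omega>. \<forall>\<^sub>F k in sequentially. \<omega> \<in> space \<Omega> - exit c k"
    by (rule borel_cantelli_AE1) (use sum in \<open>auto simp: prob_exit less_top[symmetric]\<close>)
  moreover have "AE \<omega> in \<Omega>. \<forall>K. \<omega> \<notin> (\<Inter>k\<in>{K..}. below c k)"
    unfolding AE_all_countable
  proof
    fix K
    have meas: "(\<Inter>k\<in>{K..}. below c k) \<in> events" by (intro sets.countable_INT') auto
    have "prob (\<Inter>k\<in>{K..}. below c k) \<le> F (c k) ^ k" if "k \<ge> K" for k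
      unfolding prob_below[symmetric] using that by (intro finite_measure_mono) auto
    then have "prob (\<Inter>k\<in>{K..}. below c k) \<le> 0"
      using lim by (intro LIMSEQ_le_const[OF lim]) blast
    then have "prob (\<Inter>k\<in>{K..}. below c k) = 0" using measure_nonneg antisym by blast
    then show "AE \<omega> in \<Omega>. \<omega> \<notin> (\<Inter>k\<in>{K..}. below c k)" using meas by (simp add: prob_eq_0)
  qed
  ultimately show ?thesis
  proof eventually_elim
    fix \<omega>
    assume "\<forall>\<^sub>F k in sequentially. \<omega> \<in> space \<Omega> - exit c k"
      and not_always: "\<forall>K. \<omega> \<notin> (\<Inter>k\<in>{K..}. below c k)"
    then obtain K where K: "\<And>k. k \<ge> K \<Longrightarrow> \<omega> \<notin> exit c k" by (auto simp: eventually_sequentially)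
    have step: "\<omega> \<in> below c (Suc k)" if "\<omega> \<in> below c k" "k \<ge> K" for k
    proof -
      have "\<omega> \<in> void (strip 0 k (c k)) \<inter> void (strip k (Suc k) (c k))"
        using that K[of k] by (auto simp: below_def exit_def)
      then have "\<omega> \<in> void (strip 0 (Suc k) (c k))" using void_strip_append[of 0 k "Suc k" "c k"] by simp
      then show ?thesis
        using void_strip_mono[of 0 0 "Suc k" "Suc k" "c k" "c (Suc k)"] monoD[OF mono, of k "Suc k"]
        unfolding below_def by auto
    qed
    have "\<omega> \<notin> below c k" if k: "k \<ge> K" for k
    proof
      assume b: "\<omega> \<in> below c k"
      have "\<omega> \<in> below c n" if "n \<ge> k" for n
        using that by (induction n rule: dec_induct) (use b k step in auto)
      with not_always show False by auto
    qed
    then show "\<forall>\<^sub>F k in sequentially. \<omega> \<notin> below c k" by (auto simp: eventually_sequentially)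
  qed
qed

text \<open>
  Once \<open>F (c k)\<close> tends to \<open>1\<close>, the points of an initial time interval eventually lie below the boundary.
\<close>

lemma AE_void_initial_strip:
  assumes mono: "mono c" and lim: "(\<lambda>k. F (c k)) \<longlonglongrightarrow> 1"
  shows "AE \<omega> in \<Omega>. \<forall>\<^sub>F k in sequentially. \<omega> \<in> void (strip 0 m (c k))"
proof -
  have inc: "incseq (\<lambda>k. void (strip 0 m (c k)))"
    unfolding incseq_def using mono by (intro allI impI void_strip_mono) (auto dest: monoD)
  have meas: "void (strip 0 m (c k)) \<in> events" for k by (intro sets_void sets_Times)
  have "(\<lambda>k. prob (void (strip 0 m (c k)))) \<longlonglongrightarrow> prob (\<Union>k. void (strip 0 m (c k)))"
    using meas inc by (intro finite_Lim_measure_incseq) auto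
  moreover have "(\<lambda>k. prob (void (strip 0 m (c k)))) \<longlonglongrightarrow> 1"
  proof -
    have "(\<lambda>k. F (c k) ^ m) \<longlonglongrightarrow> 1 ^ m" by (intro tendsto_power lim)
    then show ?thesis by (simp only: prob_void_strip le0) simp
  qed
  ultimately have "prob (\<Union>k. void (strip 0 m (c k))) = 1" by (rule LIMSEQ_unique)
  then have "AE \<omega> in \<Omega>. \<omega> \<in> (\<Union>k. void (strip 0 m (c k)))"
    using meas by (subst (asm) prob_eq_1) auto
  then show ?thesis
  proof eventually_elim
    fix \<omega> assume "\<omega> \<in> (\<Union>k. void (strip 0 m (c k)))"
    then obtain k where "\<omega> \<in> void (strip 0 m (c k))" by blast
    then have "\<forall>n\<ge>k. \<omega> \<in> void (strip 0 m (c n))" using inc by (auto simp: incseq_def)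
    then show "\<forall>\<^sub>F k in sequentially. \<omega> \<in> void (strip 0 m (c k))" by (auto simp: eventually_sequentially)
  qed
qed

text \<open>
  Forgetting the points before time \<open>m\<close> gives events \<open>T m\<close> that increase with \<open>m\<close>, so that their union
  is a tail event.  It differs from \<open>T 0\<close> by a null set only, because the forgotten points are
  eventually irrelevant.
\<close>

lemma below_infinitely_often_zero_one:
  assumes mono: "mono c" and lim: "(\<lambda>k. F (c k)) \<longlonglongrightarrow> 1"
  shows "prob (limsup (below c)) = 0 \<or> prob (limsup (below c)) = 1"
proof -
  \<comment> \<open>The process restarted at time \<open>m\<close> is below the boundary infinitely often.\<close>
  define T where "T m = limsup (\<lambda>k. void (strip m k (c k)))" for m
  define X where "X = (\<Union>m. T m)"
  define R where "R i = {real i<..real (Suc i)} \<times> (UNIV :: real set)" for i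
  have "disjoint_family R"
  proof -
    have "R i \<inter> R j = {}" if "i < j" for i j
      using that by (auto simp: R_def)
    then show ?thesis unfolding disjoint_family_on_def by (metis Int_commute linorder_neqE_nat)
  qed
  moreover have "X \<in> sigma_sets (space \<Omega>) (\<Union>i\<in>{n..}. {void S | S. S \<in> sets \<Lambda> \<and> S \<subseteq> R i})" for n
  proof -
    define G where "G = (\<Union>i\<in>{n..}. {void S | S. S \<in> sets \<Lambda> \<and> S \<subseteq> R i})"
    define S where "S = sigma (space \<Omega>) G"
    have "G \<subseteq> Pow (space \<Omega>)" using void_subset_space by (auto simp: G_def)
    then have sets_S: "sets S = sigma_sets (space \<Omega>) G" and space_S: "space S = space \<Omega>"
      by (auto simp: S_def space_measure_of_conv)
    have base: "void (strip k (Suc k) x) \<in> sets S" if "k \<ge> n" for k x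
    proof -
      have "strip k (Suc k) x \<in> sets \<Lambda>" by (rule sets_Times)
      moreover have "strip k (Suc k) x \<subseteq> R k" by (auto simp: R_def)
      ultimately have "void (strip k (Suc k) x) \<in> G" using that unfolding G_def by blast
      then show ?thesis unfolding sets_S by (rule sigma_sets.Basic)
    qed
    have strips: "void (strip m k x) \<in> sets S" if "m \<ge> n" for m k x
    proof (induction k)
      case 0
      have "strip m 0 x = {}" by auto
      then show ?case using sets.top[of S] by (simp add: space_S)
    next
      case (Suc k)
      show ?case
      proof (cases "m \<le> k")
        case True
        then show ?thesis
          unfolding void_strip_append[OF True le_SucI[OF order_refl]]
          using Suc base[of k x] that by auto
      next
        case False
        then have "strip m (Suc k) x = {}" by auto
        then show ?thesis using sets.top[of S] by (simp add: space_S)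
      qed
    qed
    have "T m \<in> sets S" if "m \<ge> n" for m
      unfolding T_def using strips[OF that] by (intro measurable_limsup) auto
    then have "(\<Union>m\<in>{n..}. T m) \<in> sets S" by (intro sets.countable_UN'') auto
    moreover have "X = (\<Union>m\<in>{n..}. T m)"
    proof -
      have "T m \<subseteq> T (max m n)" for m
      proof
        fix \<omega> assume "\<omega> \<in> T m"
        then have "\<exists>\<^sub>F k in sequentially. \<omega> \<in> void (strip m k (c k))"
          by (simp add: T_def mem_limsup_iff_frequently)
        then have "\<exists>\<^sub>F k in sequentially. \<omega> \<in> void (strip (max m n) k (c k))"
        proof (rule frequently_elim1)
          fix k assume "\<omega> \<in> void (strip m k (c k))"
          then show "\<omega> \<in> void (strip (max m n) k (c k))"
            using void_strip_mono[of m "max m n" k k "c k" "c k"] by auto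
        qed
        then show "\<omega> \<in> T (max m n)" by (simp add: T_def mem_limsup_iff_frequently)
      qed
      then show ?thesis unfolding X_def by fastforce
    qed
    ultimately show ?thesis by (simp add: sets_S G_def)
  qed
  ultimately have "prob X = 0 \<or> prob X = 1" by (rule void_zero_one_law)
  moreover have "prob X = prob (T 0)"
  proof (rule finite_measure_eq_AE)
    have events_T [measurable]: "T m \<in> events" for m
      unfolding T_def by (intro measurable_limsup sets_void sets_Times)
    then show "X \<in> events" "T 0 \<in> events" by (auto simp: X_def)
    have "AE \<omega> in \<Omega>. \<forall>m. \<forall>\<^sub>F k in sequentially. \<omega> \<in> void (strip 0 m (c k))"
      using AE_void_initial_strip[OF mono lim] by (simp add: AE_all_countable)
    then show "AE \<omega> in \<Omega>. \<omega> \<in> X \<longleftrightarrow> \<omega> \<in> T 0"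
    proof eventually_elim
      fix \<omega> assume init: "\<forall>m. \<forall>\<^sub>F k in sequentially. \<omega> \<in> void (strip 0 m (c k))"
      have "\<omega> \<in> T 0" if "\<omega> \<in> T m" for m
      proof -
        have "\<exists>\<^sub>F k in sequentially. \<omega> \<in> void (strip m k (c k))"
          using that by (simp add: T_def mem_limsup_iff_frequently)
        moreover have "\<forall>\<^sub>F k in sequentially. \<omega> \<in> void (strip 0 m (c k)) \<and> m \<le> k"
          using init by (intro eventually_conj eventually_ge_at_top) auto
        ultimately have "\<exists>\<^sub>F k in sequentially. \<omega> \<in> void (strip m k (c k)) \<and> (\<omega> \<in> void (strip 0 m (c k)) \<and> m \<le> k)"
          by (rule frequently_eventually_frequently)
        then have "\<exists>\<^sub>F k in sequentially. \<omega> \<in> void (strip 0 k (c k))"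
          by (rule frequently_elim1) (use void_strip_append[of 0] in auto)
        then show ?thesis by (simp add: T_def mem_limsup_iff_frequently)
      qed
      then show "\<omega> \<in> X \<longleftrightarrow> \<omega> \<in> T 0" by (auto simp: X_def)
    qed
  qed
  moreover have "T 0 = limsup (below c)" by (simp add: T_def below_def[abs_def])
  ultimately show ?thesis by simp
qed

text \<open>
  The second moment method only gives a positive probability for infinitely many exits; the zero-one
  law raises it to \<open>1\<close>.
\<close>

lemma prob_below_infinitely_often_eq_1:
  assumes mono: "mono c" and lim: "(\<lambda>k. F (c k)) \<longlonglongrightarrow> 1"
    and div: "\<not> summable (\<lambda>k. F (c k) ^ k * (1 - F (c k)))"
  shows "prob (limsup (below c)) = 1"
proof -
  have "prob (limsup (exit c)) > 0"
  proof (rule second_borel_cantelli_correlated)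
    show "\<not> summable (\<lambda>n. prob (exit c n))" using div by (simp add: prob_exit)
    fix s n
    have "(\<Sum>k\<in>{s..<n}. \<Sum>j\<in>{s..<k}. prob (exit c j \<inter> exit c k))
        = (\<Sum>k\<in>{s..<n}. \<Sum>j\<in>{s..<k}. F (c j) ^ j * F (c k) ^ (k - j - 1) * (F (c k) - F (c j)) * (1 - F (c k)))"
      by (intro sum.cong refl prob_exit_Int mono) auto
    also have "\<dots> \<le> (\<Sum>k\<in>{s..<n}. F (c k) ^ k * (1 - F (c k)))\<^sup>2
        + 4 * (\<Sum>k\<in>{s..<n}. F (c k) ^ k * (1 - F (c k)))"
      by (rule sum_two_point_bound) (use mono F_mono in \<open>auto simp: mono_def\<close>)
    finally show "(\<Sum>k\<in>{s..<n}. \<Sum>j\<in>{s..<k}. prob (exit c j \<inter> exit c k))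
        \<le> (\<Sum>k\<in>{s..<n}. prob (exit c k))\<^sup>2 + 4 * (\<Sum>k\<in>{s..<n}. prob (exit c k))"
      by (simp add: prob_exit)
  qed simp
  moreover have "prob (limsup (exit c)) \<le> prob (limsup (below c))"
  proof (rule finite_measure_mono)
    show "limsup (exit c) \<subseteq> limsup (below c)"
      unfolding subset_iff mem_limsup_iff_frequently
      using exit_subset_below by (auto elim!: frequently_elim1)
  qed (intro measurable_limsup events_below)
  ultimately show ?thesis using below_infinitely_often_zero_one[OF mono lim] by linarith
qed

end

section \<open>From the extremal process to integer times\<close>

lemma (in prob_space) completion_null_of_AE:
  assumes E: "E \<subseteq> space M" and AE: "AE x in M. x \<notin> E"
  shows "E \<in> sets (completion M)" and "measure (completion M) E = 0"
proof -
  from AE obtain Z where Z: "{x \<in> space M. \<not> x \<notin> E} \<subseteq> Z" "Z \<in> null_sets M"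
    by (auto simp: eventually_ae_filter)
  have "E \<in> null_sets (completion M)"
    unfolding null_sets_completion_iff2 using Z E by (intro bexI[of _ Z]) auto
  then show "E \<in> sets (completion M)" "measure (completion M) E = 0"
    by (auto simp: measure_eq_0_null_sets)
qed

lemma (in prob_space) completion_full_of_AE:
  assumes E: "E \<subseteq> space M" and AE: "AE x in M. x \<in> E"
  shows "E \<in> sets (completion M)" and "measure (completion M) E = 1"
proof -
  have "AE x in M. x \<notin> space M - E" using AE by eventually_elim auto
  note null = completion_null_of_AE[OF Diff_subset this]
  interpret C: prob_space "completion M"
    using prob_space emeasure_space_1 by (intro prob_spaceI) simp
  have E_eq: "E = space (completion M) - (space M - E)" using E by auto
  have "space (completion M) - (space M - E) \<in> sets (completion M)"
    by (rule sets.Diff[OF sets.top null(1)])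
  with E_eq show "E \<in> sets (completion M)" by metis
  show "measure (completion M) E = 1"
    using C.prob_compl[OF null(1)] null(2) unfolding E_eq[symmetric] by simp
qed

context extremal_point_process
begin

text \<open>
  The infimum defining the process is attained: the points above \<open>x\<close> are the countable union of those
  above \<open>x + 1 / (n + 1)\<close>.
\<close>

lemma extremal_process_le_iff:
  assumes \<omega>: "\<omega> \<in> space \<Omega>"
  shows "extremal_process N t \<omega> \<le> ereal x \<longleftrightarrow> \<omega> \<in> void ({0<..t} \<times> {x<..})"
proof
  assume "\<omega> \<in> void ({0<..t} \<times> {x<..})"
  then show "extremal_process N t \<omega> \<le> ereal x"
    unfolding extremal_process_def max_level_def by (intro Inf_lower) (auto simp: void_def)
next
  assume le: "extremal_process N t \<omega> \<le> ereal x"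
  have sets: "{0<..t} \<times> {y<..} \<in> sets (N \<omega>)" for y :: real
    using sets_realization[OF \<omega>] by simp
  have "{0<..t} \<times> {x + inverse (real (Suc n))<..} \<in> null_sets (N \<omega>)" for n
  proof -
    define e where "e = inverse (real (Suc n))"
    have "ereal x < ereal (x + e)" by (simp add: e_def)
    with le have "extremal_process N t \<omega> < ereal (x + e)" by (rule order.strict_trans1)
    then obtain y where y: "emeasure (N \<omega>) ({0<..t} \<times> {y<..}) = 0" "y < x + e"
      by (auto simp: extremal_process_def max_level_def Inf_less_iff)
    have "emeasure (N \<omega>) ({0<..t} \<times> {x + e<..}) \<le> emeasure (N \<omega>) ({0<..t} \<times> {y<..})"
      using y sets by (intro emeasure_mono) auto
    with y sets show ?thesis by (auto simp: null_sets_def e_def)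
  qed
  then have "(\<Union>n. {0<..t} \<times> {x + inverse (real (Suc n))<..}) \<in> null_sets (N \<omega>)"
    by (intro null_sets_UN)
  moreover have "(\<Union>n. {0<..t} \<times> {x + inverse (real (Suc n))<..}) = {0<..t} \<times> {x<..}"
  proof -
    have "\<exists>n. x + inverse (real (Suc n)) < y" if "x < y" for y
      using reals_Archimedean[of "y - x"] that by (auto simp: algebra_simps)
    moreover have "x < y" if "x + inverse (real (Suc n)) < y" for n y
    proof -
      have "inverse (real (Suc n)) > 0" by simp
      with that show ?thesis by linarith
    qed
    ultimately show ?thesis by (fastforce simp del: of_nat_Suc)
  qed
  ultimately show "\<omega> \<in> void ({0<..t} \<times> {x<..})" using \<omega> by (simp add: void_def null_sets_def)
qed

text \<open>
  For \<open>t\<close> between \<open>k\<close> and \<open>k + 1\<close>, a process below \<open>b t\<close> at time \<open>t\<close> was below \<open>b (k + 1)\<close> already at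
  time \<open>k\<close>.  Hence the level at \<open>k + 1\<close> is paired with time \<open>k\<close>.
\<close>

lemma eventually_above_of_not_below:
  assumes b: "mono_on {0..} b" and \<omega>: "\<omega> \<in> space \<Omega>"
    and ev: "\<forall>\<^sub>F k in sequentially. \<omega> \<notin> below (\<lambda>k. b (real (Suc k))) k"
  shows "\<omega> \<in> eventually_above \<Omega> (extremal_process N) b"
proof -
  from ev obtain K where K: "\<And>k. k \<ge> K \<Longrightarrow> \<omega> \<notin> below (\<lambda>k. b (real (Suc k))) k"
    by (auto simp: eventually_sequentially)
  have "extremal_process N t \<omega> > ereal (b t)" if t: "t \<ge> real K" for t
  proof (rule ccontr)
    assume "\<not> ?thesis"
    then have "extremal_process N t \<omega> \<le> ereal (b t)" by (simp only: not_less)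
    then have v: "\<omega> \<in> void ({0<..t} \<times> {b t<..})" by (rule extremal_process_le_iff[OF \<omega>, THEN iffD1])
    define k where "k = nat \<lfloor>t\<rfloor>"
    have "t \<ge> 0" using t by (meson of_nat_0_le_iff order_trans)
    then have k: "real k \<le> t" "t \<le> real (Suc k)" "K \<le> k"
      using t unfolding k_def by linarith+
    have "b t \<le> b (real (Suc k))" using b k \<open>t \<ge> 0\<close> by (auto simp: monotone_on_def)
    then have "strip 0 k (b (real (Suc k))) \<subseteq> {0<..t} \<times> {b t<..}" using k by auto
    then have "\<omega> \<in> below (\<lambda>k. b (real (Suc k))) k"
      using v void_antimono[OF _ sets_Times] unfolding below_def by blast
    with K[OF k(3)] show False by simp
  qed
  then show ?thesis
    using \<omega> unfolding eventually_above_def by (auto simp: eventually_at_top_linorder)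
qed

lemma not_eventually_above_of_below:
  assumes "\<omega> \<in> limsup (below (\<lambda>k. b (real k)))"
  shows "\<omega> \<notin> eventually_above \<Omega> (extremal_process N) b"
proof
  assume "\<omega> \<in> eventually_above \<Omega> (extremal_process N) b"
  then have \<omega>: "\<omega> \<in> space \<Omega>" and ev: "\<forall>\<^sub>F t in at_top. extremal_process N t \<omega> > ereal (b t)"
    by (auto simp: eventually_above_def)
  have "\<forall>\<^sub>F k in sequentially. extremal_process N (real k) \<omega> > ereal (b (real k))"
    using filterlim_real_sequentially ev by (rule eventually_compose_filterlim[rotated])
  then have "\<forall>\<^sub>F k in sequentially. \<omega> \<notin> below (\<lambda>k. b (real k)) k"
    by eventually_elim (use extremal_process_le_iff[OF \<omega>] in \<open>simp add: below_def flip: not_le\<close>)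
  with assms show False by (simp add: mem_limsup_iff_frequently frequently_def)
qed

section \<open>The dichotomy\<close>

context
  fixes b g :: "real \<Rightarrow> real"
  assumes b: "mono_on {0..} b" and g_def: "g = (\<lambda>t. 1 - F (b t))"
begin

abbreviation E :: "'w set" where
  "E \<equiv> eventually_above \<Omega> (extremal_process N) b"

lemma g_nonneg [simp]: "0 \<le> g t" and g_le_1 [simp]: "g t \<le> 1"
  by (simp_all add: g_def)

lemma F_eq: "F (b t) = 1 - g t"
  by (simp add: g_def)

lemma antimono_g: "antimono_on {0..} g"
  using b by (auto simp: g_def monotone_on_def intro!: F_mono)

lemma g_antimono: "0 \<le> s \<Longrightarrow> s \<le> t \<Longrightarrow> g t \<le> g s"
  using antimono_g by (auto simp: monotone_on_def)

lemma mono_levels: "mono (\<lambda>k. b (real k))" "mono (\<lambda>k. b (real (Suc k)))"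
  using b by (auto simp: mono_def monotone_on_def)

lemma one_minus_power_le_exp: "(1 - g t) ^ k \<le> exp (- real k * g t)"
proof -
  have "(1 - g t) ^ k \<le> exp (- g t) ^ k"
    using exp_ge_add_one_self[of "- g t"] by (intro power_mono) auto
  also have "\<dots> = exp (- real k * g t)" by (simp flip: exp_of_nat_mult)
  finally show ?thesis .
qed

text \<open>
  In each case of the theorem the event either contains the complement of a null event or lies inside a
  null event.  Its measurability with respect to the completion comes for free, although it is defined
  through uncountably many times.
\<close>

lemma E_full:
  assumes "AE \<omega> in \<Omega>. \<forall>\<^sub>F k in sequentially. \<omega> \<notin> below (\<lambda>k. b (real (Suc k))) k"
  shows "E \<in> sets (completion \<Omega>)" "measure (completion \<Omega>) E = 1"
proof -
  have sub: "E \<subseteq> space \<Omega>" by (auto simp: eventually_above_def)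
  have "AE \<omega> in \<Omega>. \<omega> \<in> E"
    using assms AE_space by eventually_elim (rule eventually_above_of_not_below[OF b])
  from completion_full_of_AE[OF sub this]
  show "E \<in> sets (completion \<Omega>)" "measure (completion \<Omega>) E = 1" .
qed

lemma E_null:
  assumes "prob (limsup (below (\<lambda>k. b (real k)))) = 1"
  shows "E \<in> sets (completion \<Omega>)" "measure (completion \<Omega>) E = 0"
proof -
  have sub: "E \<subseteq> space \<Omega>" by (auto simp: eventually_above_def)
  have "limsup (below (\<lambda>k. b (real k))) \<in> events" by (intro measurable_limsup events_below)
  with assms have "AE \<omega> in \<Omega>. \<omega> \<in> limsup (below (\<lambda>k. b (real k)))" by (simp add: prob_eq_1)
  then have "AE \<omega> in \<Omega>. \<omega> \<notin> E" by eventually_elim (rule not_eventually_above_of_below)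
  from completion_null_of_AE[OF sub this]
  show "E \<in> sets (completion \<Omega>)" "measure (completion \<Omega>) E = 0" .
qed

text \<open>
  Here the probabilities of being below the boundary decay geometrically in time, whatever the
  position of the boundary relative to the atoms of \<open>F\<close>.
\<close>

lemma E_full_if_limit_pos:
  assumes c: "c > 0" and lim: "(g \<longlongrightarrow> c) at_top"
  shows "E \<in> sets (completion \<Omega>)" "measure (completion \<Omega>) E = 1"
proof -
  have ge: "c \<le> g t" if "t \<ge> 0" for t
  proof (rule tendsto_upperbound[OF lim])
    show "\<forall>\<^sub>F s in at_top. g s \<le> g t"
      using eventually_ge_at_top[of t] by eventually_elim (use g_antimono that in auto)
  qed simp
  have c1: "c \<le> 1" using ge[of 0] g_le_1[of 0] by linarith
  have "summable (\<lambda>k. prob (below (\<lambda>k. b (real (Suc k))) k))"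
  proof (rule summable_comparison_test')
    show "summable (\<lambda>k. (1 - c) ^ k)" using c c1 by (intro summable_geometric) auto
    show "norm (prob (below (\<lambda>k. b (real (Suc k))) k)) \<le> (1 - c) ^ k" if "k \<ge> 0" for k
      using ge[of "real (Suc k)"] unfolding prob_below F_eq
      by (auto intro!: power_mono simp del: of_nat_Suc)
  qed
  then have "AE \<omega> in \<Omega>. \<forall>\<^sub>F k in sequentially. \<omega> \<in> space \<Omega> - below (\<lambda>k. b (real (Suc k))) k"
    by (intro borel_cantelli_AE1) (auto simp: less_top[symmetric])
  then have "AE \<omega> in \<Omega>. \<forall>\<^sub>F k in sequentially. \<omega> \<notin> below (\<lambda>k. b (real (Suc k))) k"
    by eventually_elim (auto elim: eventually_mono)
  from E_full[OF this] show "E \<in> sets (completion \<Omega>)" "measure (completion \<Omega>) E = 1" .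
qed

lemma levels_tendsto_1:
  assumes "(g \<longlongrightarrow> 0) at_top"
  shows "(\<lambda>k. F (b (real k))) \<longlonglongrightarrow> 1"
proof -
  have "(\<lambda>k. g (real k)) \<longlonglongrightarrow> 0" using assms filterlim_real_sequentially by (rule filterlim_compose)
  then have "(\<lambda>k. 1 - g (real k)) \<longlonglongrightarrow> 1 - 0" by (intro tendsto_intros)
  then show ?thesis by (simp add: F_eq)
qed

text \<open>
  At infinitely many integer times the probability \<open>(1 - g k) ^ k\<close> of being below the boundary is
  bounded away from \<open>0\<close>, and the zero-one law applies.
\<close>

lemma E_null_if_not_at_top:
  assumes lim: "(g \<longlongrightarrow> 0) at_top" and not: "\<not> filterlim (\<lambda>t. t * g t) at_top at_top"
  shows "E \<in> sets (completion \<Omega>)" "measure (completion \<Omega>) E = 0"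
proof -
  obtain C where C: "\<exists>\<^sub>F t in at_top. t * g t < C"
    using not by (auto simp: filterlim_at_top not_eventually not_le)
  have "\<forall>\<^sub>F t in at_top. g t < 1/2" using lim by (rule order_tendstoD) simp
  then obtain T where T: "\<And>t. t \<ge> T \<Longrightarrow> g t < 1/2" by (auto simp: eventually_at_top_linorder)
  have "\<exists>\<^sub>F k in sequentially. exp (- 3 * (C + 1)) \<le> prob (below (\<lambda>k. b (real k)) k)"
    unfolding frequently_sequentially
  proof
    fix n
    obtain t where t: "t \<ge> max T (real n)" "t * g t < C"
      using C unfolding frequently_def eventually_at_top_linorder by (meson not_less)
    define k where "k = nat \<lceil>t\<rceil>"
    have t0: "0 \<le> t" using t(1) by (meson max.boundedE of_nat_0_le_iff order_trans)
    then have k: "t \<le> real k" "real k \<le> t + 1" unfolding k_def by linarith+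
    \<comment> \<open>Rounding \<open>t\<close> up costs at most \<open>1\<close> in the product, as \<open>g\<close> does not increase and is at most \<open>1\<close>.\<close>
    have gk: "g (real k) \<le> g t" using k t0 by (intro g_antimono)
    have "real k * g (real k) \<le> (t + 1) * g t" using k gk t0 by (intro mult_mono) auto
    also have "\<dots> = t * g t + g t" by (simp add: distrib_right)
    also have "\<dots> \<le> C + 1" using t(2) g_le_1[of t] by linarith
    finally have kC: "real k * g (real k) \<le> C + 1" .
    have "real k * (g (real k))\<^sup>2 \<le> real k * (g (real k) * 1)"
      unfolding power2_eq_square by (intro mult_left_mono) auto
    then have "real k * (g (real k))\<^sup>2 \<le> C + 1" using kC by simp
    then have "exp (- real k * g (real k)) \<le> exp (2 * (C + 1)) * (1 - g (real k)) ^ k"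
      using T[of "real k"] k t(1) by (intro exp_le_const_times_power) auto
    moreover have "exp (- (C + 1)) \<le> exp (- real k * g (real k))" using kC by simp
    ultimately have "exp (- (C + 1)) \<le> exp (2 * (C + 1)) * (1 - g (real k)) ^ k" by linarith
    then have "exp (- 2 * (C + 1)) * exp (- (C + 1))
        \<le> exp (- 2 * (C + 1)) * (exp (2 * (C + 1)) * (1 - g (real k)) ^ k)"
      by (intro mult_left_mono) auto
    also have "\<dots> = (1 - g (real k)) ^ k" by (simp flip: exp_add mult.assoc)
    also have "exp (- 2 * (C + 1)) * exp (- (C + 1)) = exp (- 3 * (C + 1))" by (simp flip: exp_add)
    finally have "exp (- 3 * (C + 1)) \<le> prob (below (\<lambda>k. b (real k)) k)"
      by (simp add: prob_below F_eq)
    moreover have "n \<le> k" using t(1) k(1) by linarith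
    ultimately show "\<exists>k\<ge>n. exp (- 3 * (C + 1)) \<le> prob (below (\<lambda>k. b (real k)) k)" by blast
  qed
  then have "exp (- 3 * (C + 1)) \<le> prob (limsup (below (\<lambda>k. b (real k))))"
    by (intro prob_limsup_ge_frequently) auto
  moreover have "0 < exp (- 3 * (C + 1))" by simp
  ultimately have "prob (limsup (below (\<lambda>k. b (real k)))) = 1"
    using below_infinitely_often_zero_one[OF mono_levels(1) levels_tendsto_1[OF lim]] by linarith
  from E_null[OF this] show "E \<in> sets (completion \<Omega>)" "measure (completion \<Omega>) E = 0" .
qed

text \<open>
  The exits from the boundary \<open>b\<close> at integer times have probabilities \<open>(1 - g k) ^ k * g k\<close>, whose sum
  diverges together with \<open>J\<close>.
\<close>

lemma E_null_if_J_infinite: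
  assumes lim: "(g \<longlongrightarrow> 0) at_top" and tg: "filterlim (\<lambda>t. t * g t) at_top at_top"
    and J: "J_integral g = \<infinity>"
  shows "E \<in> sets (completion \<Omega>)" "measure (completion \<Omega>) E = 0"
proof -
  have "(\<lambda>k. g (real k)) \<longlonglongrightarrow> 0" using lim filterlim_real_sequentially by (rule filterlim_compose)
  then have "\<not> summable (\<lambda>k. g (real k) * (1 - g (real k)) ^ k)"
    using not_summable_of_J_integral_infinite[OF antimono_g _ _ tg J]
      summable_exp_of_summable_power[of "\<lambda>k. g (real k)"] by auto
  then have "\<not> summable (\<lambda>k. F (b (real k)) ^ k * (1 - F (b (real k))))"
    by (simp add: F_eq mult.commute)
  from prob_below_infinitely_often_eq_1[OF mono_levels(1) levels_tendsto_1[OF lim] this]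
  show "E \<in> sets (completion \<Omega>)" "measure (completion \<Omega>) E = 0" by (fact E_null)+
qed

text \<open>
  The same for the shifted levels \<open>b (k + 1)\<close>, whose exits have summable probabilities.
\<close>

lemma E_full_if_J_finite:
  assumes tg: "filterlim (\<lambda>t. t * g t) at_top at_top" and J: "J_integral g < \<infinity>"
  shows "E \<in> sets (completion \<Omega>)" "measure (completion \<Omega>) E = 1"
proof -
  define G where "G k = g (real (Suc k))" for k
  have G: "0 \<le> G k" "G k \<le> 1" for k by (simp_all add: G_def)
  have pow: "(1 - G k) ^ k \<le> exp (- real k * G k)" for k
    unfolding G_def by (rule one_minus_power_le_exp)
  have "summable (\<lambda>k. (1 - G k) ^ k * G k)"
  proof (rule summable_comparison_test')
    show "summable (\<lambda>k. G k * exp (- real k * G k))"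
      unfolding G_def using antimono_g _ _ tg J by (rule summable_of_J_integral_finite) simp_all
    show "norm ((1 - G k) ^ k * G k) \<le> G k * exp (- real k * G k)" if "k \<ge> 0" for k
      using G[of k] mult_left_mono[OF pow[of k], of "G k"] by (simp add: mult.commute)
  qed
  moreover have "(\<lambda>k. (1 - G k) ^ k) \<longlonglongrightarrow> 0"
  proof (rule tendsto_sandwich[where f = "\<lambda>_. 0"])
    show "\<forall>\<^sub>F k in sequentially. (1 - G k) ^ k \<le> exp 1 * exp (- (real (Suc k) * G k))"
    proof (rule always_eventually, rule allI)
      fix k
      have "exp (- real k * G k) \<le> exp (1 + - (real (Suc k) * G k))"
        using G[of k] by (simp add: algebra_simps)
      with pow[of k] show "(1 - G k) ^ k \<le> exp 1 * exp (- (real (Suc k) * G k))"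
        by (simp only: exp_add)
    qed
    show "\<forall>\<^sub>F k in sequentially. 0 \<le> (1 - G k) ^ k" using G by simp
    have "filterlim (\<lambda>k. real (Suc k)) at_top sequentially"
      by (rule filterlim_compose[OF filterlim_real_sequentially filterlim_Suc])
    then have "filterlim (\<lambda>k. real (Suc k) * G k) at_top sequentially"
      unfolding G_def by (rule filterlim_compose[OF tg])
    then have "filterlim (\<lambda>k. - (real (Suc k) * G k)) at_bot sequentially"
      by (simp add: filterlim_uminus_at_bot)
    then have "(\<lambda>k. exp (- (real (Suc k) * G k))) \<longlonglongrightarrow> 0"
      by (rule filterlim_compose[OF exp_at_bot])
    then show "(\<lambda>k. exp 1 * exp (- (real (Suc k) * G k))) \<longlonglongrightarrow> 0" by (rule tendsto_mult_right_zero)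
  qed simp
  ultimately have "AE \<omega> in \<Omega>. \<forall>\<^sub>F k in sequentially. \<omega> \<notin> below (\<lambda>k. b (real (Suc k))) k"
    by (intro AE_eventually_not_below mono_levels(2)) (simp_all add: F_eq G_def)
  from E_full[OF this] show "E \<in> sets (completion \<Omega>)" "measure (completion \<Omega>) E = 1" .
qed

lemma g_convergent:
  obtains c where "c \<ge> 0" "(g \<longlongrightarrow> c) at_top"
proof -
  have "decseq (\<lambda>k. g (real k))" by (auto simp: decseq_def intro: g_antimono)
  then obtain c where c: "(\<lambda>k. g (real k)) \<longlonglongrightarrow> c"
    using decseq_convergent[of "\<lambda>k. g (real k)" 0] by auto
  have "((\<lambda>t. - g (max 0 t)) \<longlongrightarrow> - c) at_top"
  proof (rule tendsto_at_topI_sequentially_real)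
    show "mono (\<lambda>t. - g (max 0 t))" by (auto simp: mono_def intro!: g_antimono)
    show "(\<lambda>n. - g (max 0 (real n))) \<longlonglongrightarrow> - c" using c by (simp add: tendsto_minus)
  qed
  then have "((\<lambda>t. g (max 0 t)) \<longlongrightarrow> c) at_top" by (simp add: tendsto_minus_cancel_left)
  moreover have "\<forall>\<^sub>F t in at_top. g (max 0 t) = g t"
    using eventually_ge_at_top[of 0] by eventually_elim simp
  ultimately have "(g \<longlongrightarrow> c) at_top" by (rule Lim_transform_eventually)
  moreover have "c \<ge> 0" using c by (rule LIMSEQ_le_const) simp
  ultimately show thesis by (rule that[rotated])
qed

text \<open>
  As \<open>g\<close> is monotone and bounded, it converges, and the cases treated above are exhaustive.
\<close>

lemma E_zero_one:
  "E \<in> sets (completion \<Omega>) \<and> (measure (completion \<Omega>) E = 0 \<or> measure (completion \<Omega>) E = 1)"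
proof -
  obtain c where c: "c \<ge> 0" "(g \<longlongrightarrow> c) at_top" by (rule g_convergent)
  show ?thesis
  proof (cases "c > 0")
    case True
    then show ?thesis using E_full_if_limit_pos c by blast
  next
    case False
    then have lim: "(g \<longlongrightarrow> 0) at_top" using c by simp
    have "J_integral g = \<infinity> \<or> J_integral g < \<infinity>" by (auto simp: less_top[symmetric])
    then show ?thesis
      using E_null_if_not_at_top[OF lim] E_null_if_J_infinite[OF lim] E_full_if_J_finite by blast
  qed
qed

end

end

theorem theorem2:
  fixes D :: "real measure" and F :: "real \<Rightarrow> real"
    and \<Omega> :: "'w measure" and N :: "'w \<Rightarrow> (real \<times> real) measure"
    and \<Lambda> :: "(real \<times> real) measure"
    and M :: "real \<Rightarrow> 'w \<Rightarrow> ereal" and b g :: "real \<Rightarrow> real" and E :: "'w set"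
  assumes "real_distribution D" and "F = cdf D"
    and "\<And>x. lower_endpoint F = ereal x \<Longrightarrow> F x = 0"
    and "extremal_intensity F \<Lambda>"
    and "poisson_point_process \<Omega> N \<Lambda>"
    and "M = extremal_process N"
    and "mono_on {0..} b"
    and "\<And>t. t \<ge> 0 \<Longrightarrow> continuous (at_right t) b"
    and "g = (\<lambda>t. 1 - F (b t))"
    and "E = eventually_above \<Omega> M b"
  shows
    "(E \<in> sets (completion \<Omega>) \<and>
       (measure (completion \<Omega>) E = 0 \<or> measure (completion \<Omega>) E = 1)) \<and>
     (\<forall>c > 0. (g \<longlongrightarrow> c) at_top \<longrightarrow> measure (completion \<Omega>) E = 1) \<and>
     ((g \<longlongrightarrow> 0) at_top \<longrightarrow> Liminf at_top (\<lambda>t. ereal (t * g t)) < \<infinity> \<longrightarrow>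
        measure (completion \<Omega>) E = 0) \<and>
     ((g \<longlongrightarrow> 0) at_top \<longrightarrow> filterlim (\<lambda>t. t * g t) at_top at_top \<longrightarrow>
        (J_integral g = \<infinity> \<longrightarrow> measure (completion \<Omega>) E = 0) \<and>
        (J_integral g < \<infinity> \<longrightarrow> measure (completion \<Omega>) E = 1))"
proof -
  interpret extremal_point_process \<Omega> N \<Lambda> D F
    by (intro extremal_point_process.intro extremal_point_process_axioms.intro) fact+
  have E: "E = eventually_above \<Omega> (extremal_process N) b" using assms by simp
  have not_at_top: "\<not> filterlim (\<lambda>t. t * g t) at_top at_top"
    if "Liminf at_top (\<lambda>t. ereal (t * g t)) < \<infinity>"
  proof
    assume "filterlim (\<lambda>t. t * g t) at_top at_top"
    then have "((\<lambda>t. ereal (t * g t)) \<longlongrightarrow> \<infinity>) at_top" by (simp add: tendsto_PInfty_eq_at_top)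
    then have "Liminf at_top (\<lambda>t. ereal (t * g t)) = \<infinity>" by (rule lim_imp_Liminf[rotated]) simp
    with that show False by simp
  qed
  note b = \<open>mono_on {0..} b\<close> and g = \<open>g = (\<lambda>t. 1 - F (b t))\<close>
  show ?thesis
    unfolding E
    using E_zero_one[OF b g] E_full_if_limit_pos(2)[OF b g] E_null_if_not_at_top(2)[OF b g _ not_at_top]
      E_null_if_J_infinite(2)[OF b g] E_full_if_J_finite(2)[OF b g]
    by blast
qed

end
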